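(* Let $\{\mathbf{C}(N)\}_{N\ge 0}$ be the Half-Plane Half-Comb (HPHC) random walk on $\mathbb{Z}^2$ started at $(0,0)$, with local time $\Xi((k,j),N)$. For all integers $k_1,k_2$ we have: $$\lim_{N\to\infty}\frac{\Xi((k_1,j_1),N)}{\Xi((k_2,j_2),N)}=1\quad\text{a.s.}$$ for all integers $j_1,j_2$ such that either $j_1\ge 0,\ j_2\ge 0$, or $j_1<0,\ j_2<0$; and $$\lim_{N\to\infty}\frac{\Xi((k_1,j_1),N)}{\Xi((k_2,j_2),N)}=2\quad\text{a.s.}$$ for all integers $j_1\ge 0$ and $j_2<0$.
   Context: The HPHC random walk $\mathbf{C}(N)=(C_1(N),C_2(N))$, $N=0,1,2,\ldots$, is the time-homogeneous Markov chain on $\mathbb{Z}^2$ with one-step transition probabilities $$\mathbf{P}(\mathbf{C}(N+1)=(k\pm1,j)\mid \mathbf{C}(N)=(k,j))=\tfrac12-p_j \quad\text{(for each choice of sign)},$$ $$\mathbf{P}(\mathbf{C}(N+1)=(k,j\pm1)\mid \mathbf{C}(N)=(k,j))=p_j \quad\text{(for each choice of sign)},$$ where $p_j=\tfrac14$ for $j\ge 0$ and $p_j=\tfrac12$ for $j<0$. Its local time is $\Xi((k,j),N)=\sum_{r=0}^{N} I\{\mathbf{C}(r)=(k,j)\}$ for $(k,j)\in\mathbb{Z}^2$, where $I\{\cdot\}$ is the indicator. *)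

theory Defs
  imports "HOL-Probability.Probability"
begin

(* The Markov property is stated for the full history, conditioning only on histories of
   positive probability. All state spaces are discrete, with every subset measurable. *)
definition markov_chain :: "'a measure \<Rightarrow> (nat \<Rightarrow> 'a \<Rightarrow> 's) \<Rightarrow> ('s \<Rightarrow> 's \<Rightarrow> real) \<Rightarrow> bool" where
  "markov_chain M X K \<longleftrightarrow>
     prob_space M \<and>
     (\<forall>n. X n \<in> M \<rightarrow>\<^sub>M count_space UNIV) \<and>
     (\<forall>N (x :: nat \<Rightarrow> 's) y.
        \<P>(\<omega> in M. \<forall>i\<le>N. X i \<omega> = x i) > 0 \<longrightarrow>
        \<P>(\<omega> in M. X (Suc N) \<omega> = y \<bar> \<forall>i\<le>N. X i \<omega> = x i) = K (x N) y)"

definition hphc_p :: "int \<Rightarrow> real" where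
  "hphc_p j = (if j \<ge> 0 then 1/4 else 1/2)"

definition hphc_step :: "int \<times> int \<Rightarrow> int \<times> int \<Rightarrow> real" where
  "hphc_step = (\<lambda>(k, j) y.
     if y = (k + 1, j) \<or> y = (k - 1, j) then 1/2 - hphc_p j
     else if y = (k, j + 1) \<or> y = (k, j - 1) then hphc_p j
     else 0)"

definition hphc_walk :: "'a measure \<Rightarrow> (nat \<Rightarrow> 'a \<Rightarrow> int \<times> int) \<Rightarrow> bool" where
  "hphc_walk M C \<longleftrightarrow> markov_chain M C hphc_step \<and> (AE \<omega> in M. C 0 \<omega> = (0, 0))"

definition local_time :: "(nat \<Rightarrow> 'a \<Rightarrow> 's) \<Rightarrow> 's \<Rightarrow> nat \<Rightarrow> 'a \<Rightarrow> real" where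
  "local_time X z N \<omega> = (\<Sum>r\<le>N. of_bool (X r \<omega> = z))"

end

theory Submission
  imports Defs "HOL-Library.Discrete_Functions"
begin

text \<open>The weight \<open>\<mu>\<close> equal to 2 on the rows \<open>j \<ge> 0\<close> and 1 on the teeth is reversible, and a logarithmic
  Lyapunov function shows that bounded subharmonic functions are constant; so the walk is
  recurrent. For states \<open>a \<noteq> b\<close> the probability \<open>h\<close> of hitting \<open>a\<close> before \<open>b\<close> is harmonic off
  \<open>{a, b}\<close>, and reversal of paths gives \<open>h - P h = c (1\<^sub>a / \<mu> a - 1\<^sub>b / \<mu> b)\<close> with \<open>c > 0\<close>.
  Hence \<open>c (\<Xi>(a) / \<mu> a - \<Xi>(b) / \<mu> b)\<close> is a martingale up to a bounded term. Stopped after \<open>n\<close> visits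
  to \<open>{a, b}\<close> its second moment is at most \<open>4 n + 4\<close>, because \<open>P h\<^sup>2 - h\<^sup>2\<close> controls the quadratic
  variation. Along \<open>n = m\<^sup>2\<close> this makes it \<open>o(n)\<close> almost surely, and since the stopped sum changes by
  at most 1 with each visit, this holds along all \<open>n\<close>.\<close>

section \<open>Finite-range kernels and their potentials\<close>

locale finite_range_kernel =
  fixes K :: "'s \<Rightarrow> 's \<Rightarrow> real" and nb :: "'s \<Rightarrow> 's set"
  assumes finite_nb [simp]: "finite (nb x)"
    and K_nonneg [simp]: "0 \<le> K x y"
    and K_outside: "y \<notin> nb x \<Longrightarrow> K x y = 0"
    and sum_K: "(\<Sum>y\<in>nb x. K x y) = 1"
begin

definition avg :: "('s \<Rightarrow> real) \<Rightarrow> 's \<Rightarrow> real" where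
  "avg \<phi> x = (\<Sum>y\<in>nb x. K x y * \<phi> y)"

lemma avg_const [simp]: "avg (\<lambda>_. c) x = c"
  by (simp add: avg_def sum_K flip: sum_distrib_right)

lemma avg_mono: "(\<And>y. \<phi> y \<le> \<psi> y) \<Longrightarrow> avg \<phi> x \<le> avg \<psi> x"
  unfolding avg_def by (intro sum_mono mult_left_mono) auto

lemma avg_add: "avg (\<lambda>y. \<phi> y + \<psi> y) x = avg \<phi> x + avg \<psi> x"
  by (simp add: avg_def sum.distrib algebra_simps)

lemma avg_diff: "avg (\<lambda>y. \<phi> y - \<psi> y) x = avg \<phi> x - avg \<psi> x"
  by (simp add: avg_def sum_subtractf algebra_simps)

lemma avg_cmult: "avg (\<lambda>y. c * \<phi> y) x = c * avg \<phi> x"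
  by (simp add: avg_def sum_distrib_left mult_ac)

lemma avg_sum: "avg (\<lambda>y. \<Sum>i\<in>I. \<phi> i y) x = (\<Sum>i\<in>I. avg (\<phi> i) x)"
  unfolding avg_def by (simp add: sum_distrib_left sum.swap[of _ I])

lemma avg_of_bool_eq: "avg (\<lambda>y. of_bool (y = a)) x = K x a"
  using K_outside[of a x] by (simp add: avg_def of_bool_def if_distrib sum.delta cong: if_cong)

lemma avg_bounds:
  assumes "\<And>y. 0 \<le> \<phi> y \<and> \<phi> y \<le> 1"
  shows "0 \<le> avg \<phi> x \<and> avg \<phi> x \<le> 1"
  using avg_mono[of "\<lambda>_. 0" \<phi> x] avg_mono[of \<phi> "\<lambda>_. 1" x] assms by simp

lemma avg_tendsto:
  assumes "\<And>y. (\<lambda>n. \<phi> n y) \<longlonglongrightarrow> \<psi> y"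
  shows "(\<lambda>n. avg (\<phi> n) x) \<longlonglongrightarrow> avg \<psi> x"
  unfolding avg_def by (intro tendsto_sum tendsto_mult assms tendsto_const)

text \<open>At a maximum the gaps \<open>\<phi> x - \<phi> z\<close> are nonnegative, while
  subharmonicity makes their average at most 0; so every gap carrying positive weight
  vanishes.\<close>

lemma avg_maximum:
  assumes "\<phi> x \<le> avg \<phi> x" and max: "\<And>y. \<phi> y \<le> \<phi> x" and "K x y > 0"
  shows "\<phi> y = \<phi> x"
proof -
  have "(\<Sum>z\<in>nb x. K x z * (\<phi> x - \<phi> z)) = \<phi> x - avg \<phi> x"
    using avg_diff[of "\<lambda>_. \<phi> x" \<phi> x] by (simp add: avg_def[of "\<lambda>y. _ y - _ y"] avg_def[of "\<lambda>y. _ - _ y"])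
  moreover have "0 \<le> (\<Sum>z\<in>nb x. K x z * (\<phi> x - \<phi> z))"
    using max by (intro sum_nonneg mult_nonneg_nonneg) auto
  ultimately have "(\<Sum>z\<in>nb x. K x z * (\<phi> x - \<phi> z)) = 0"
    using assms(1) by linarith
  moreover have "y \<in> nb x"
    using assms(3) K_outside[of y x] by force
  ultimately have "K x y * (\<phi> x - \<phi> y) = 0"
    using max by (subst (asm) sum_nonneg_eq_0_iff) auto
  with assms(3) show ?thesis by simp
qed

text \<open>Subtracting a small multiple of the Lyapunov function \<open>f\<close> forces the maximum of a bounded
  subharmonic function to be attained, and attained in the exceptional set \<open>F\<close>.\<close>

lemma liouville_lyapunov:
  assumes irr: "\<And>S. S \<noteq> {} \<Longrightarrow> (\<And>x y. x \<in> S \<Longrightarrow> K x y > 0 \<Longrightarrow> y \<in> S) \<Longrightarrow> S = UNIV"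
    and F: "finite F" "F \<noteq> {}"
    and f_nonneg: "\<And>x. 0 \<le> f x"
    and f_super: "\<And>x. x \<notin> F \<Longrightarrow> avg f x \<le> f x"
    and f_level: "\<And>c. finite {x. f x \<le> c}"
    and sub: "\<And>x. \<phi> x \<le> avg \<phi> x" and bdd: "\<And>x. \<phi> x \<le> B"
  shows "\<phi> x = \<phi> y"
proof -
  have step1: "\<exists>z\<in>F. \<forall>x. \<phi> x - e * f x \<le> \<phi> z - e * f z" if "e > 0" for e
  proof -
    define g where "g = (\<lambda>x. \<phi> x - e * f x)"
    define x0 where "x0 = (SOME x. x \<in> F)"
    \<comment> \<open>Since \<open>\<phi>\<close> is bounded, this superlevel set of
      \<open>g\<close> lies in a level set of \<open>f\<close>; it is finite, so \<open>g\<close>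
      attains its maximum.\<close>
    define S where "S = {x. g x0 \<le> g x}"
    have "S \<subseteq> {x. f x \<le> (B - g x0) / e}"
    proof
      fix x assume "x \<in> S"
      then have "e * f x \<le> B - g x0"
        using bdd[of x] by (simp add: S_def g_def)
      then show "x \<in> {x. f x \<le> (B - g x0) / e}"
        using that by (simp add: field_simps)
    qed
    then have fin: "finite S"
      using f_level finite_subset by blast
    have "S \<noteq> {}"
      by (auto simp: S_def)
    then obtain z where z: "z \<in> S" "\<And>x. x \<in> S \<Longrightarrow> g x \<le> g z"
      using fin obtains_MAX[OF fin] by (metis Max_ge finite_imageI imageI)
    have z_max: "g x \<le> g z" for x
      using z(1) z(2)[of x] by (cases "x \<in> S") (auto simp: S_def)
    define Mx where "Mx = {x. \<forall>y. g y \<le> g x}"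
    have "Mx \<inter> F \<noteq> {}"
    proof
      assume disj: "Mx \<inter> F = {}"
      \<comment> \<open>Off \<open>F\<close> the function \<open>g\<close> is subharmonic, so a set
        of maximisers missing \<open>F\<close> is closed under steps.\<close>
      have "Mx = UNIV"
      proof (rule irr)
        show "Mx \<noteq> {}" using z_max by (auto simp: Mx_def)
        fix x y assume x: "x \<in> Mx" and K: "K x y > 0"
        with disj have "avg f x \<le> f x" by (intro f_super) auto
        then have "g x \<le> avg g x"
          using that sub[of x] mult_left_mono[of "avg f x" "f x" e]
          unfolding g_def avg_diff avg_cmult by linarith
        then have "g y = g x"
          using x K by (intro avg_maximum) (auto simp: Mx_def)
        with x show "y \<in> Mx" by (simp add: Mx_def)
      qed
      with disj F show False by auto
    qed
    then show ?thesis by (auto simp: Mx_def g_def)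
  qed
  define m where "m = Max (\<phi> ` F)"
  have le_m: "\<phi> x \<le> m" for x
  proof (rule ccontr)
    assume "\<not> \<phi> x \<le> m"
    \<comment> \<open>With this \<open>e\<close> the penalty \<open>e * (f x + 1)\<close> is half
      the excess of \<open>\<phi> x\<close> over \<open>m\<close>, too little to close the
      gap.\<close>
    define e where "e = (\<phi> x - m) / 2 / (f x + 1)"
    have f1: "f x + 1 > 0" using f_nonneg[of x] by linarith
    then have e: "e > 0" using \<open>\<not> \<phi> x \<le> m\<close> by (simp add: e_def)
    obtain z where z: "z \<in> F" "\<phi> x - e * f x \<le> \<phi> z - e * f z"
      using step1[OF e] by blast
    have "\<phi> z \<le> m" unfolding m_def using z F by (intro Max_ge) auto
    moreover have "0 \<le> e * f z" using e f_nonneg by simp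
    moreover have "e * f x \<le> e * (f x + 1)" using e by simp
    moreover have "e * (f x + 1) = (\<phi> x - m) / 2" by (metis e_def f1 less_irrefl nonzero_eq_divide_eq)
    ultimately have "\<phi> x \<le> m + (\<phi> x - m) / 2" using z(2) by linarith
    with \<open>\<not> \<phi> x \<le> m\<close> show False by (simp add: field_simps)
  qed
  have "{x. \<phi> x = m} = UNIV"
  proof (rule irr)
    have "m \<in> \<phi> ` F" unfolding m_def using F by (intro Max_in) auto
    then show "{x. \<phi> x = m} \<noteq> {}" by auto
    fix x y assume "x \<in> {x. \<phi> x = m}" "K x y > 0"
    then show "y \<in> {x. \<phi> x = m}"
      using avg_maximum[OF sub[of x], of y] le_m by auto
  qed
  then have "\<phi> z = m" for z by (metis (mono_tags, lifting) UNIV_I mem_Collect_eq)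
  then show ?thesis by simp
qed

end

section \<open>Avoidance, hitting probabilities and the two-point potential\<close>

text \<open>Recurrence enters as a Liouville property: it forces avoidance probabilities to 0 and
  makes the hitting probabilities of two states complementary.\<close>

locale recurrent_reversible_kernel = finite_range_kernel K nb
  for K :: "'s \<Rightarrow> 's \<Rightarrow> real" and nb :: "'s \<Rightarrow> 's set" +
  fixes \<mu> :: "'s \<Rightarrow> real"
  assumes \<mu>_pos: "0 < \<mu> x"
    and reversible: "\<mu> x * K x y = \<mu> y * K y x"
    and liouville: "(\<And>x. \<phi> x \<le> avg \<phi> x) \<Longrightarrow> (\<And>x. 0 \<le> \<phi> x \<and> \<phi> x \<le> 1) \<Longrightarrow> \<phi> x = \<phi> y"
begin

text \<open>First-step recursion for the probability that a chain started at \<open>x\<close> avoids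
  \<open>a\<close> at times 0 to \<open>n\<close>; \<open>prob_avoid\<close> makes the link to the
  chain.\<close>

primrec avoid :: "'s \<Rightarrow> nat \<Rightarrow> 's \<Rightarrow> real" where
  "avoid a 0 x = of_bool (x \<noteq> a)"
| "avoid a (Suc n) x = of_bool (x \<noteq> a) * avg (avoid a n) x"

lemma avoid_bounds: "0 \<le> avoid a n x \<and> avoid a n x \<le> 1"
  by (induction n arbitrary: x) (use avg_bounds in auto)

lemma avoid_Suc_le: "avoid a (Suc n) x \<le> avoid a n x"
proof (induction n arbitrary: x)
  case 0
  then show ?case using avg_bounds[of "avoid a 0" x] avoid_bounds[of a 0] by auto
next
  case (Suc n)
  then show ?case using avg_mono[of "avoid a (Suc n)" "avoid a n" x] by (cases "x = a") auto
qed

text \<open>The decreasing limit is subharmonic, because forcing the value 0 at \<open>a\<close> can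
  only lie below an average; hence it is constant, and its value at \<open>a\<close> is 0.\<close>

lemma avoid_tendsto_0: "(\<lambda>n. avoid a n x) \<longlonglongrightarrow> 0"
proof -
  have "\<exists>l. (\<lambda>n. avoid a n x) \<longlonglongrightarrow> l" for x
    using decseq_convergent[of "\<lambda>n. avoid a n x" 0] avoid_bounds
    by (metis avoid_Suc_le decseq_Suc_iff)
  then obtain q where q: "\<And>x. (\<lambda>n. avoid a n x) \<longlonglongrightarrow> q x" by metis
  have "q x = q a"
  proof (rule liouville)
    fix x
    have "(\<lambda>n. avoid a (Suc n) x) \<longlonglongrightarrow> q x"
      using q by (rule LIMSEQ_Suc)
    moreover have "avoid a (Suc n) x \<le> avg (avoid a n) x" for n
      using avg_bounds[of "avoid a n" x] avoid_bounds[of a n] by auto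
    ultimately show "q x \<le> avg q x"
      using avg_tendsto[of "avoid a" q, OF q, of x] by (blast intro: LIMSEQ_le)
    show "0 \<le> q x \<and> q x \<le> 1"
      using q[of x] avoid_bounds by (meson LIMSEQ_le_const LIMSEQ_le_const2)
  qed
  moreover have "avoid a n a = 0" for n by (cases n) auto
  with q[of a] have "q a = 0" by (simp add: LIMSEQ_const_iff)
  ultimately show ?thesis using q[of x] by simp
qed

text \<open>For \<open>a \<noteq> b\<close>, the probability of reaching \<open>a\<close> within
  \<open>n\<close> steps without meeting \<open>b\<close> first.\<close>

primrec hit :: "'s \<Rightarrow> 's \<Rightarrow> nat \<Rightarrow> 's \<Rightarrow> real" where
  "hit a b 0 x = of_bool (x = a)"
| "hit a b (Suc n) x = (if x = a then 1 else if x = b then 0 else avg (hit a b n) x)"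

lemma hit_bounds: "0 \<le> hit a b n x \<and> hit a b n x \<le> 1"
  by (induction n arbitrary: x) (use avg_bounds in auto)

lemma hit_le_Suc: "a \<noteq> b \<Longrightarrow> hit a b n x \<le> hit a b (Suc n) x"
proof (induction n arbitrary: x)
  case 0
  then show ?case using avg_bounds[of "hit a b 0" x] hit_bounds[of a b 0] by auto
next
  case (Suc n)
  then show ?case using avg_mono[of "hit a b n" "hit a b (Suc n)" x] by auto
qed

lemma hit_swap_le: "a \<noteq> b \<Longrightarrow> hit a b n x + hit b a n x \<le> 1"
proof (induction n arbitrary: x)
  case 0
  then show ?case by auto
next
  case (Suc n)
  then show ?case
    using avg_mono[of "\<lambda>x. hit a b n x + hit b a n x" "\<lambda>_. 1" x] by (auto simp: avg_add)
qed

text \<open>The weight of the paths from \<open>x\<close> to \<open>y\<close> in \<open>n + 1\<close> steps whose intermediate points avoid \<open>A\<close>.\<close>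

primrec taboo :: "'s set \<Rightarrow> nat \<Rightarrow> 's \<Rightarrow> 's \<Rightarrow> real" where
  "taboo A 0 x y = K x y"
| "taboo A (Suc n) x y = avg (\<lambda>z. of_bool (z \<notin> A) * taboo A n z y) x"

lemma K_outside': "z \<notin> nb y \<Longrightarrow> K z y = 0"
  using reversible[of z y] K_outside[of z y] \<mu>_pos[of z] by simp

text \<open>The defining recursion splits off the first step; splitting off the last one as well is
  what lets reversal of paths be proved by induction.\<close>

lemma taboo_Suc_right:
  "taboo A (Suc n) x y = (\<Sum>z\<in>nb y. taboo A n x z * of_bool (z \<notin> A) * K z y)"
proof (induction n arbitrary: x)
  case 0
  \<comment> \<open>\<open>K x z\<close> lives on \<open>nb x\<close> and, by reversibility,
    \<open>K z y\<close> lives on \<open>nb y\<close>; both sums reduce to the intersection.\<close>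
  have "(\<Sum>z\<in>nb x. K x z * (of_bool (z \<notin> A) * K z y))
      = (\<Sum>z\<in>nb x \<inter> nb y. K x z * (of_bool (z \<notin> A) * K z y))"
    by (rule sum.mono_neutral_right) (auto simp: K_outside')
  also have "\<dots> = (\<Sum>z\<in>nb y. K x z * (of_bool (z \<notin> A) * K z y))"
    by (rule sum.mono_neutral_left) (auto, metis K_outside)
  finally show ?case by (simp add: avg_def mult.assoc)
next
  case (Suc n)
  have "taboo A (Suc (Suc n)) x y = avg (\<lambda>z. of_bool (z \<notin> A) * taboo A (Suc n) z y) x"
    by simp
  also have "\<dots> = avg (\<lambda>z. \<Sum>w\<in>nb y. (of_bool (w \<notin> A) * K w y) * (of_bool (z \<notin> A) * taboo A n z w)) x"
    unfolding Suc by (simp add: sum_distrib_left mult_ac)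
  also have "\<dots> = (\<Sum>w\<in>nb y. taboo A (Suc n) x w * of_bool (w \<notin> A) * K w y)"
    by (simp add: avg_sum avg_cmult mult_ac)
  finally show ?case .
qed

text \<open>Reversibility carries \<open>\<mu>\<close> across the first step and the induction
  hypothesis across the rest, which leaves the last-step decomposition of the reversed path.\<close>

lemma taboo_reversible: "\<mu> x * taboo A n x y = \<mu> y * taboo A n y x"
proof (induction n arbitrary: x y)
  case 0
  then show ?case by (simp add: reversible)
next
  case (Suc n)
  have "\<mu> x * taboo A (Suc n) x y
      = (\<Sum>z\<in>nb x. (\<mu> x * K x z) * of_bool (z \<notin> A) * taboo A n z y)"
    by (simp add: avg_def sum_distrib_left mult_ac)
  also have "\<dots> = (\<Sum>z\<in>nb x. K z x * of_bool (z \<notin> A) * (\<mu> z * taboo A n z y))"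
    by (simp add: reversible[of x] mult_ac)
  also have "\<dots> = \<mu> y * taboo A (Suc n) y x"
    unfolding Suc[of _ y] taboo_Suc_right by (simp add: sum_distrib_left mult_ac)
  finally show ?case .
qed

text \<open>After one forced step, reaching \<open>a\<close> before \<open>b\<close> is split by the
  time \<open>k + 1\<close> of the first entry into \<open>{a, b}\<close>.\<close>

lemma avg_hit: "a \<noteq> b \<Longrightarrow> avg (hit a b n) x = (\<Sum>k\<le>n. taboo {a, b} k x a)"
proof (induction n arbitrary: x)
  case 0
  then show ?case by (simp add: avg_of_bool_eq)
next
  case (Suc n)
  have "hit a b (Suc n) = (\<lambda>z. of_bool (z = a) +
      (\<Sum>k\<le>n. of_bool (z \<notin> {a, b}) * taboo {a, b} k z a))"
    using Suc.IH[OF Suc.prems] Suc.prems by (auto simp flip: sum_distrib_left)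
  then have "avg (hit a b (Suc n)) x = K x a + (\<Sum>k\<le>n. taboo {a, b} (Suc k) x a)"
    by (simp only: avg_add avg_sum avg_of_bool_eq taboo.simps)
  then show ?case
    by (simp only: sum.atMost_Suc_shift taboo.simps(1))
qed

text \<open>\<open>h\<close> is the limit of \<open>hit a b n\<close>, harmonic off the two states;
  the main point is that its defects at \<open>a\<close> and \<open>b\<close>, weighted by
  \<open>\<mu>\<close>, cancel.\<close>

lemma potential_exists:
  assumes ab: "a \<noteq> b"
  shows "\<exists>h c. 0 < c \<and> (\<forall>x. 0 \<le> h x \<and> h x \<le> 1) \<and>
    (\<forall>x. h x - avg h x = c * (of_bool (x = a) / \<mu> a - of_bool (x = b) / \<mu> b))"
proof -
  have lim: "\<exists>l. (\<lambda>n. hit a b n x) \<longlonglongrightarrow> l" if "a \<noteq> b" for a b x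
    using incseq_convergent[of "\<lambda>n. hit a b n x" 1] hit_bounds[of a b _ x] hit_le_Suc[OF that]
    by (metis incseq_Suc_iff)
  obtain h where h: "\<And>x. (\<lambda>n. hit a b n x) \<longlonglongrightarrow> h x" using lim[OF ab] by metis
  obtain h' where h': "\<And>x. (\<lambda>n. hit b a n x) \<longlonglongrightarrow> h' x" using lim[of b a] ab by metis
  have h_bounds: "0 \<le> h x \<and> h x \<le> 1" for x
    using h[of x] hit_bounds by (meson LIMSEQ_le_const LIMSEQ_le_const2)
  have h'_bounds: "0 \<le> h' x \<and> h' x \<le> 1" for x
    using h'[of x] hit_bounds by (meson LIMSEQ_le_const LIMSEQ_le_const2)
  have eq: "(if x = a then 1 else if x = b then 0 else avg h x) = h x" for x
    using LIMSEQ_Suc[OF h[of x]] avg_tendsto[of "hit a b" h, OF h, of x] LIMSEQ_unique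
    by (auto simp: LIMSEQ_const_iff)
  have eq': "(if x = b then 1 else if x = a then 0 else avg h' x) = h' x" for x
    using LIMSEQ_Suc[OF h'[of x]] avg_tendsto[of "hit b a" h', OF h', of x] LIMSEQ_unique
    by (auto simp: LIMSEQ_const_iff)
  have sum_le: "h x + h' x \<le> 1" for x
    using LIMSEQ_le_const2[OF tendsto_add[OF h[of x] h'[of x]]] hit_swap_le[OF ab] by blast
  \<comment> \<open>The probability of never meeting \<open>a\<close> or \<open>b\<close>; being
    subharmonic and 0 at \<open>a\<close>, it vanishes.\<close>
  define k where "k = (\<lambda>x. 1 - (h x + h' x))"
  have k_bounds: "0 \<le> k x \<and> k x \<le> 1" for x
    using sum_le[of x] h_bounds[of x] h'_bounds[of x] by (simp add: k_def)
  have ka: "k a = 0" and kb: "k b = 0"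
    using eq[of a] eq'[of a] eq[of b] eq'[of b] ab by (auto simp: k_def)
  have "k x = k a" for x
  proof (rule liouville)
    fix x
    show "k x \<le> avg k x"
    proof (cases "x = a \<or> x = b")
      case True
      then show ?thesis using ka kb avg_bounds[of k x] k_bounds by auto
    next
      case False
      then show ?thesis
        using eq[of x] eq'[of x] by (simp add: k_def avg_diff avg_add)
    qed
  qed (rule k_bounds)
  then have h'_eq: "h' = (\<lambda>x. 1 - h x)"
    using ka by (simp add: k_def fun_eq_iff algebra_simps)
  \<comment> \<open>Both sides weigh the paths between the two states with interior off
    \<open>{a, b}\<close>, read in opposite directions.\<close>
  have "\<mu> b * avg (hit a b n) b = \<mu> a * avg (hit b a n) a" for n
    using ab by (simp add: avg_hit sum_distrib_left taboo_reversible[of b] insert_commute)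
  moreover have "(\<lambda>n. \<mu> b * avg (hit a b n) b) \<longlonglongrightarrow> \<mu> b * avg h b"
    "(\<lambda>n. \<mu> a * avg (hit b a n) a) \<longlonglongrightarrow> \<mu> a * avg h' a"
    by (intro tendsto_mult tendsto_const avg_tendsto h h')+
  ultimately have "\<mu> b * avg h b = \<mu> a * avg h' a"
    using LIMSEQ_unique by fastforce
  then have rev: "\<mu> b * avg h b = \<mu> a * (1 - avg h a)"
    by (simp add: h'_eq avg_diff)
  define c where "c = \<mu> b * avg h b"
  have pot: "h x - avg h x = c * (of_bool (x = a) / \<mu> a - of_bool (x = b) / \<mu> b)" for x
  proof -
    consider "x = a" | "x = b" | "x \<noteq> a" "x \<noteq> b" by blast
    then show ?thesis
    proof cases
      case 1
      then show ?thesis using eq[of a] ab rev \<mu>_pos[of a] by (simp add: c_def)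
    next
      case 2
      then show ?thesis using eq[of b] ab \<mu>_pos[of b] by (simp add: c_def)
    next
      case 3
      then show ?thesis using eq[of x] by simp
    qed
  qed
  \<comment> \<open>For \<open>c = 0\<close> the function \<open>h\<close> would be harmonic, hence
    constant, against \<open>h a = 1\<close> and \<open>h b = 0\<close>.\<close>
  have "c \<noteq> 0"
  proof
    assume "c = 0"
    with pot have "h x \<le> avg h x" for x by (metis diff_0_right diff_le_0_iff_le mult_zero_left order_refl)
    then have "h a = h b" by (rule liouville) (rule h_bounds)
    then show False using eq[of a] eq[of b] ab by simp
  qed
  moreover have "c \<ge> 0"
    using \<mu>_pos[of b] avg_bounds[of h b] h_bounds by (simp add: c_def)
  ultimately have "0 < c" by simp
  with h_bounds pot show ?thesis by blast
qed

end

section \<open>Path expectations and recurrence\<close>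

text \<open>The newest state comes first, so that a step of the chain is a \<open>Cons\<close> and
  the present state is the head.\<close>

primrec hist :: "(nat \<Rightarrow> 'a \<Rightarrow> 's) \<Rightarrow> nat \<Rightarrow> 'a \<Rightarrow> 's list" where
  "hist X 0 \<omega> = [X 0 \<omega>]"
| "hist X (Suc n) \<omega> = X (Suc n) \<omega> # hist X n \<omega>"

lemma hd_hist: "hd (hist X n \<omega>) = X n \<omega>"
  by (cases n) auto

lemma length_hist: "length (hist X n \<omega>) = Suc n"
  by (induction n) auto

lemma hist_eq_iff: "length l = Suc n \<Longrightarrow> hist X n \<omega> = l \<longleftrightarrow> (\<forall>i\<le>n. X i \<omega> = l ! (n - i))"
proof (induction n arbitrary: l)
  case 0
  then show ?case by (auto simp: length_Suc_conv)
next
  case (Suc n)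
  then obtain y l' where l: "l = y # l'" "length l' = Suc n" by (auto simp: length_Suc_conv)
  show ?case using Suc.IH[OF l(2)] l by (auto simp: le_Suc_eq Suc_diff_le)
qed

text \<open>The pointwise form of measurability with respect to the first \<open>n + 1\<close>
  states; for a chain of finite range it already gives integrability.\<close>

definition adapted :: "(nat \<Rightarrow> 'a \<Rightarrow> 's) \<Rightarrow> nat \<Rightarrow> ('a \<Rightarrow> real) \<Rightarrow> bool" where
  "adapted X n f \<longleftrightarrow> (\<forall>\<omega> \<omega>'. (\<forall>i\<le>n. X i \<omega> = X i \<omega>') \<longrightarrow> f \<omega> = f \<omega>')"

lemma adapted_hist:
  assumes "adapted X n f"
  obtains G where "f = (\<lambda>\<omega>. G (hist X n \<omega>))"
proof
  show "f = (\<lambda>\<omega>. (\<lambda>l. f (SOME \<omega>'. hist X n \<omega>' = l)) (hist X n \<omega>))"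
  proof
    fix \<omega>
    define \<omega>' where "\<omega>' = (SOME \<omega>'. hist X n \<omega>' = hist X n \<omega>)"
    have "hist X n \<omega>' = hist X n \<omega>"
      unfolding \<omega>'_def by (rule someI) (rule refl)
    then have "\<forall>i\<le>n. X i \<omega>' = X i \<omega>"
      using hist_eq_iff[OF length_hist[of X n \<omega>], where X = X and \<omega> = \<omega>]
        hist_eq_iff[OF length_hist[of X n \<omega>], where X = X and \<omega> = \<omega>'] by auto
    then show "f \<omega> = f (SOME \<omega>'. hist X n \<omega>' = hist X n \<omega>)"
      using assms unfolding adapted_def \<omega>'_def by metis
  qed
qed

section \<open>The law of finite paths\<close>

locale finite_range_markov_chain = finite_range_kernel K nb
  for K :: "'s :: countable \<Rightarrow> 's \<Rightarrow> real" and nb :: "'s \<Rightarrow> 's set" +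
  fixes M :: "'a measure" and X :: "nat \<Rightarrow> 'a \<Rightarrow> 's" and x0 :: 's
  assumes chain: "markov_chain M X K"
    and start: "AE \<omega> in M. X 0 \<omega> = x0"

sublocale finite_range_markov_chain \<subseteq> prob_space M
  using chain by (simp add: markov_chain_def)

context finite_range_markov_chain
begin

lemma X_measurable [measurable]: "X n \<in> M \<rightarrow>\<^sub>M count_space UNIV"
  using chain by (simp add: markov_chain_def)

lemma hist_measurable [measurable]: "hist X n \<in> M \<rightarrow>\<^sub>M count_space UNIV"
proof (induction n)
  case 0
  then show ?case by simp
next
  case (Suc n)
  show ?case
    unfolding hist.simps by (rule measurable_compose_countable[OF _ Suc]) simp
qed

primrec paths :: "nat \<Rightarrow> 's list set" where
  "paths 0 = {[x0]}"
| "paths (Suc n) = (\<lambda>(l, y). y # l) ` (SIGMA l:paths n. nb (hd l))"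

lemma finite_paths [simp]: "finite (paths n)"
  by (induction n) auto

lemma length_paths: "l \<in> paths n \<Longrightarrow> length l = Suc n"
  by (induction n arbitrary: l) auto

lemma prob_hist_Suc:
  assumes "length l = Suc n"
  shows "prob {\<omega> \<in> space M. hist X (Suc n) \<omega> = y # l} = prob {\<omega> \<in> space M. hist X n \<omega> = l} * K (hd l) y"
proof -
  define x where "x = (\<lambda>i. l ! (n - i))"
  have hist_l: "hist X n \<omega> = l \<longleftrightarrow> (\<forall>i\<le>n. X i \<omega> = x i)" for \<omega>
    using hist_eq_iff[OF assms, where X = X] by (simp add: x_def)
  have "x n = hd l" using assms by (cases l) (auto simp: x_def)
  have ev: "{\<omega> \<in> space M. hist X (Suc n) \<omega> = y # l} = {\<omega> \<in> space M. X (Suc n) \<omega> = y \<and> hist X n \<omega> = l}"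
    by auto
  show ?thesis
  proof (cases "prob {\<omega> \<in> space M. hist X n \<omega> = l} > 0")
    case True
    then have "\<P>(\<omega> in M. X (Suc n) \<omega> = y \<bar> hist X n \<omega> = l) = K (hd l) y"
      using chain by (simp add: markov_chain_def hist_l flip: \<open>x n = hd l\<close>)
    with True show ?thesis by (simp add: cond_prob_def ev field_simps)
  next
    \<comment> \<open>The Markov property is silent on null histories; there both sides are
      0.\<close>
    case False
    then have "prob {\<omega> \<in> space M. hist X n \<omega> = l} = 0"
      by (simp add: zero_less_measure_iff)
    moreover have "prob {\<omega> \<in> space M. hist X (Suc n) \<omega> = y # l} \<le> prob {\<omega> \<in> space M. hist X n \<omega> = l}"
      unfolding ev by (rule finite_measure_mono) auto
    ultimately show ?thesis using measure_nonneg[of M] by (simp add: order_antisym)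
  qed
qed

lemma sum_paths_Suc: "(\<Sum>l\<in>paths (Suc n). F l) = (\<Sum>l\<in>paths n. \<Sum>y\<in>nb (hd l). F (y # l))"
  by (simp add: sum.reindex inj_on_def sum.Sigma case_prod_unfold)

lemma sum_prob_paths: "(\<Sum>l\<in>paths n. prob {\<omega> \<in> space M. hist X n \<omega> = l}) = 1"
proof (induction n)
  case 0
  have "AE \<omega> in M. hist X 0 \<omega> = [x0]" using start by simp
  then show ?case using prob_Collect_eq_1[of "\<lambda>\<omega>. hist X 0 \<omega> = [x0]"] by simp
next
  case (Suc n)
  have "(\<Sum>l\<in>paths (Suc n). prob {\<omega> \<in> space M. hist X (Suc n) \<omega> = l})
      = (\<Sum>l\<in>paths n. \<Sum>y\<in>nb (hd l). prob {\<omega> \<in> space M. hist X n \<omega> = l} * K (hd l) y)"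
    unfolding sum_paths_Suc by (intro sum.cong refl prob_hist_Suc length_paths)
  also have "\<dots> = 1"
    using Suc by (simp add: sum_K flip: sum_distrib_left)
  finally show ?case .
qed

lemma AE_hist: "AE \<omega> in M. hist X n \<omega> \<in> paths n"
proof -
  have "prob (\<Union>l\<in>paths n. {\<omega> \<in> space M. hist X n \<omega> = l}) = 1"
    by (subst finite_measure_finite_Union) (auto simp: sum_prob_paths disjoint_family_on_def)
  also have "(\<Union>l\<in>paths n. {\<omega> \<in> space M. hist X n \<omega> = l}) = {\<omega> \<in> space M. hist X n \<omega> \<in> paths n}"
    by auto
  finally show ?thesis by (subst (asm) prob_Collect_eq_1) auto
qed

text \<open>The history lies almost surely in the finite set \<open>paths n\<close>, so
  \<open>F\<close> of it agrees with a simple function.\<close>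

lemma integral_hist:
  fixes F :: "'s list \<Rightarrow> real"
  shows "integrable M (\<lambda>\<omega>. F (hist X n \<omega>))"
    and "expectation (\<lambda>\<omega>. F (hist X n \<omega>)) = (\<Sum>l\<in>paths n. prob {\<omega> \<in> space M. hist X n \<omega> = l} * F l)"
proof -
  define S where "S = (\<lambda>\<omega>. \<Sum>l\<in>paths n. F l * indicator {\<omega> \<in> space M. hist X n \<omega> = l} \<omega>)"
  have eq: "AE \<omega> in M. S \<omega> = F (hist X n \<omega>)"
    using AE_hist[of n] AE_space
  proof eventually_elim
    case (elim \<omega>)
    have "S \<omega> = (\<Sum>l\<in>paths n. if l = hist X n \<omega> then F l else 0)"
      unfolding S_def using elim by (intro sum.cong) (auto simp: indicator_def)
    then show ?case using elim by simp
  qed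
  have ind: "integrable M (indicat_real {\<omega> \<in> space M. hist X n \<omega> = l})" for l
    by (rule integrable_real_indicator) (auto simp: less_top[symmetric])
  have S_int: "integrable M S"
    unfolding S_def by (intro Bochner_Integration.integrable_sum integrable_mult_right ind)
  show "integrable M (\<lambda>\<omega>. F (hist X n \<omega>))"
    using S_int by (rule integrable_cong_AE_imp) (use eq in auto)
  have "expectation (\<lambda>\<omega>. F (hist X n \<omega>)) = expectation S"
    by (rule integral_cong_AE) (use eq S_int in auto)
  also have "\<dots> = (\<Sum>l\<in>paths n. prob {\<omega> \<in> space M. hist X n \<omega> = l} * F l)"
    unfolding S_def by (subst Bochner_Integration.integral_sum) (auto simp: mult.commute ind)
  finally show "expectation (\<lambda>\<omega>. F (hist X n \<omega>)) = (\<Sum>l\<in>paths n. prob {\<omega> \<in> space M. hist X n \<omega> = l} * F l)" .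
qed

lemma adapted_integrable: "adapted X n f \<Longrightarrow> integrable M f"
  using integral_hist(1) by (elim adapted_hist) auto

text \<open>Summing the product form of the path law over the last step produces \<open>avg\<close>;
  this is the Markov property tested against an arbitrary function of the past.\<close>

lemma expectation_Suc:
  assumes "adapted X n g"
  shows "expectation (\<lambda>\<omega>. g \<omega> * \<phi> (X (Suc n) \<omega>)) = expectation (\<lambda>\<omega>. g \<omega> * avg \<phi> (X n \<omega>))"
proof -
  obtain G where G: "g = (\<lambda>\<omega>. G (hist X n \<omega>))" using assms by (rule adapted_hist)
  have "expectation (\<lambda>\<omega>. g \<omega> * \<phi> (X (Suc n) \<omega>)) =
      expectation (\<lambda>\<omega>. (\<lambda>l. G (tl l) * \<phi> (hd l)) (hist X (Suc n) \<omega>))"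
    by (simp add: G)
  also have "\<dots> = (\<Sum>l\<in>paths n. \<Sum>y\<in>nb (hd l). prob {\<omega> \<in> space M. hist X n \<omega> = l} * K (hd l) y * (G l * \<phi> y))"
    unfolding integral_hist(2)[where n = "Suc n" and F = "\<lambda>l. G (tl l) * \<phi> (hd l)"] sum_paths_Suc
    by (intro sum.cong refl arg_cong2[where f = "(*)"] prob_hist_Suc length_paths) auto
  also have "\<dots> = (\<Sum>l\<in>paths n. prob {\<omega> \<in> space M. hist X n \<omega> = l} * (G l * avg \<phi> (hd l)))"
    by (simp add: avg_def sum_distrib_left sum_distrib_right mult_ac)
  also have "\<dots> = expectation (\<lambda>\<omega>. g \<omega> * avg \<phi> (X n \<omega>))"
    unfolding integral_hist(2)[symmetric] by (simp add: G hd_hist)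
  finally show ?thesis .
qed

end

section \<open>Recurrence of the chain\<close>

locale recurrent_reversible_chain =
  recurrent_reversible_kernel K nb \<mu> + finite_range_markov_chain K nb M X x0
  for K :: "'s :: countable \<Rightarrow> 's \<Rightarrow> real" and nb \<mu> M and X :: "nat \<Rightarrow> 'a \<Rightarrow> 's" and x0
begin

lemma prob_avoid:
  "prob {\<omega> \<in> space M. \<forall>i\<in>{n..n + k}. X i \<omega> \<noteq> a} = expectation (\<lambda>\<omega>. avoid a k (X n \<omega>))"
proof -
  \<comment> \<open>Generalised over the number \<open>m\<close> of steps already survived, so that
    \<open>expectation_Suc\<close> can advance the present time by one at each stage of the
    induction.\<close>
  have "expectation (\<lambda>\<omega>. of_bool (\<forall>i\<in>{n..<n + m}. X i \<omega> \<noteq> a) * avoid a k (X (n + m) \<omega>)) =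
      prob {\<omega> \<in> space M. \<forall>i\<in>{n..n + m + k}. X i \<omega> \<noteq> a}" for m
  proof (induction k arbitrary: m)
    case 0
    have "expectation (\<lambda>\<omega>. of_bool (\<forall>i\<in>{n..<n + m}. X i \<omega> \<noteq> a) * avoid a 0 (X (n + m) \<omega>))
       = expectation (indicator {\<omega> \<in> space M. \<forall>i\<in>{n..n + m}. X i \<omega> \<noteq> a})"
    proof (rule Bochner_Integration.integral_cong)
      fix \<omega> assume "\<omega> \<in> space M"
      moreover have "{n..n + m} = insert (n + m) {n..<n + m}" by auto
      ultimately show "of_bool (\<forall>i\<in>{n..<n + m}. X i \<omega> \<noteq> a) * avoid a 0 (X (n + m) \<omega>)
         = indicator {\<omega> \<in> space M. \<forall>i\<in>{n..n + m}. X i \<omega> \<noteq> a} \<omega>"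
        by (auto simp: indicator_def)
    qed simp
    then show ?case by simp
  next
    case (Suc k)
    have "expectation (\<lambda>\<omega>. of_bool (\<forall>i\<in>{n..<n + m}. X i \<omega> \<noteq> a) * avoid a (Suc k) (X (n + m) \<omega>))
      = expectation (\<lambda>\<omega>. of_bool (\<forall>i\<in>{n..<n + Suc m}. X i \<omega> \<noteq> a) * avg (avoid a k) (X (n + m) \<omega>))"
      by (intro Bochner_Integration.integral_cong refl) (auto simp: less_Suc_eq atLeastLessThanSuc)
    also have "\<dots> = expectation (\<lambda>\<omega>. of_bool (\<forall>i\<in>{n..<n + Suc m}. X i \<omega> \<noteq> a) * avoid a k (X (n + Suc m) \<omega>))"
      unfolding add_Suc_right by (rule expectation_Suc[symmetric]) (auto simp: adapted_def less_Suc_eq_le)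
    finally show ?case using Suc.IH[of "Suc m"] by simp
  qed
  from this[of 0] show ?thesis by simp
qed

text \<open>The chance of avoiding \<open>a\<close> from time \<open>n\<close> on is at most the
  expectation of \<open>avoid a k\<close> at \<open>X n\<close>, which tends to 0 by dominated
  convergence.\<close>

lemma infinitely_often: "AE \<omega> in M. \<forall>n. \<exists>i\<ge>n. X i \<omega> = a"
proof -
  have "AE \<omega> in M. \<not> (\<forall>i\<ge>n. X i \<omega> \<noteq> a)" for n
  proof -
    have "(\<lambda>k. expectation (\<lambda>\<omega>. avoid a k (X n \<omega>))) \<longlonglongrightarrow> expectation (\<lambda>\<omega>. 0)"
    proof (rule integral_dominated_convergence[where w = "\<lambda>_. 1"])
      show "AE \<omega> in M. (\<lambda>k. avoid a k (X n \<omega>)) \<longlonglongrightarrow> 0" by (simp add: avoid_tendsto_0)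
    qed (use avoid_bounds in auto)
    moreover have "prob {\<omega> \<in> space M. \<forall>i\<ge>n. X i \<omega> \<noteq> a} \<le> expectation (\<lambda>\<omega>. avoid a k (X n \<omega>))" for k
      unfolding prob_avoid[symmetric] by (rule finite_measure_mono) auto
    ultimately have "prob {\<omega> \<in> space M. \<forall>i\<ge>n. X i \<omega> \<noteq> a} \<le> 0"
      using LIMSEQ_le_const by fastforce
    then have "prob {\<omega> \<in> space M. \<forall>i\<ge>n. X i \<omega> \<noteq> a} = 0"
      using measure_nonneg[of M] by (simp add: order_antisym)
    then show ?thesis by (subst (asm) prob_Collect_eq_0) auto
  qed
  then show ?thesis by (subst AE_all_countable) auto
qed

end

section \<open>Sums stopped after a number of visits\<close>

definition visits :: "'s set \<Rightarrow> (nat \<Rightarrow> 's) \<Rightarrow> nat \<Rightarrow> nat" where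
  "visits A x r = (\<Sum>i\<le>r. of_bool (x i \<in> A))"

lemma visits_0: "visits A x 0 = of_bool (x 0 \<in> A)"
  and visits_Suc: "visits A x (Suc r) = visits A x r + of_bool (x (Suc r) \<in> A)"
  by (simp_all add: visits_def)

lemma visits_mono: "r \<le> s \<Longrightarrow> visits A x r \<le> visits A x s"
  unfolding visits_def by (rule sum_mono2) auto

lemma antimono_visits_le: "antimono (\<lambda>r. visits A x r \<le> n)"
proof (intro antimonoI le_boolI)
  fix r s :: nat assume "r \<le> s" "visits A x s \<le> n"
  then show "visits A x r \<le> n" using visits_mono[of r s A x] by simp
qed

lemma sum_first_visits:
  "(\<Sum>r\<le>N. of_bool (visits A x r \<le> n) * of_bool (x r \<in> A)) = real (min n (visits A x N))"
proof (induction N)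
  case 0
  show ?case by (cases "x 0 \<in> A") (simp_all add: visits_0 min_def del: sum_of_bool_mult_eq sum_mult_of_bool_eq sum_of_bool_eq)
next
  case (Suc N)
  show ?case unfolding sum.atMost_Suc Suc visits_Suc by (auto simp: min_def)
qed

lemma sum_stopped_increments:
  fixes g :: "nat \<Rightarrow> real"
  assumes "antimono P"
  shows "\<exists>m. (\<Sum>r<N. of_bool (P r) * (g (Suc r) - g r)) = g m - g 0"
proof -
  \<comment> \<open>The extra clause keeps \<open>m = N\<close> while \<open>P\<close> has not
    failed, so that the next increment telescopes.\<close>
  have "\<exists>m. (\<Sum>r<N. of_bool (P r) * (g (Suc r) - g r)) = g m - g 0 \<and> ((\<forall>r<N. P r) \<longrightarrow> m = N)"
  proof (induction N)
    case 0
    then show ?case by auto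
  next
    case (Suc N)
    then obtain m where m: "(\<Sum>r<N. of_bool (P r) * (g (Suc r) - g r)) = g m - g 0" "(\<forall>r<N. P r) \<longrightarrow> m = N"
      by blast
    show ?case
    proof (cases "P N")
      case True
      then have "\<forall>r<N. P r" using antimonoD[OF assms, of _ N] by (auto simp: le_bool_def)
      with m True show ?thesis by (intro exI[of _ "Suc N"]) simp
    next
      case False
      with m show ?thesis by (intro exI[of _ m]) auto
    qed
  qed
  then show ?thesis by blast
qed

text \<open>\<open>visits\<close> includes the present visit, so the indicator is known at time
  \<open>r\<close>; for \<open>v\<close> supported on \<open>A\<close> the terms that survive are
  those of the first \<open>n\<close> visits.\<close>

definition visit_term :: "'s set \<Rightarrow> ('s \<Rightarrow> real) \<Rightarrow> nat \<Rightarrow> (nat \<Rightarrow> 's) \<Rightarrow> nat \<Rightarrow> real" where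
  "visit_term A v n x r = of_bool (visits A x r \<le> n) * v (x r)"

context
  fixes A :: "'s set" and v :: "'s \<Rightarrow> real"
  assumes v_bound: "\<And>y. \<bar>v y\<bar> \<le> of_bool (y \<in> A)"
begin

text \<open>The two terms differ only at visits numbered \<open>m + 1\<close> to \<open>n\<close>,
  and each of these contributes at most 1.\<close>

lemma sum_visit_term_diff:
  assumes "m \<le> n"
  shows "(\<Sum>r<N. \<bar>visit_term A v n x r - visit_term A v m x r\<bar>) \<le> real n - real m"
proof (cases N)
  case 0
  then show ?thesis using assms by simp
next
  case (Suc N')
  have "(\<Sum>r<N. \<bar>visit_term A v n x r - visit_term A v m x r\<bar>)
      \<le> (\<Sum>r<N. of_bool (visits A x r \<le> n) * of_bool (x r \<in> A) - of_bool (visits A x r \<le> m) * of_bool (x r \<in> A))"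
  proof (rule sum_mono)
    fix r
    show "\<bar>visit_term A v n x r - visit_term A v m x r\<bar>
        \<le> of_bool (visits A x r \<le> n) * of_bool (x r \<in> A) - of_bool (visits A x r \<le> m) * of_bool (x r \<in> A)"
      using assms v_bound[of "x r"] by (cases "x r \<in> A") (auto simp: visit_term_def)
  qed
  also have "\<dots> = real (min n (visits A x N')) - real (min m (visits A x N'))"
    unfolding Suc lessThan_Suc_atMost sum_subtractf sum_first_visits by simp
  also have "\<dots> \<le> real n - real m"
    using assms by (auto simp: min_def)
  finally show ?thesis .
qed

lemma visit_term_0: "visit_term A v 0 x r = 0"
proof (cases "x r \<in> A")
  case True
  then have "visits A x r \<ge> of_bool (x r \<in> A)"
    unfolding visits_def by (intro member_le_sum) auto
  with True show ?thesis by (simp add: visit_term_def)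
next
  case False
  then show ?thesis using v_bound[of "x r"] by (simp add: visit_term_def)
qed

lemma sum_abs_visit_term: "(\<Sum>r<N. \<bar>visit_term A v n x r\<bar>) \<le> real n"
  using sum_visit_term_diff[of 0 n x N] by (simp add: visit_term_0)

lemma abs_sum_visit_term: "\<bar>\<Sum>r<N. visit_term A v n x r\<bar> \<le> real n"
  using sum_abs_visit_term[where n = n and x = x and N = N] sum_abs[of "visit_term A v n x" "{..<N}"] by linarith

lemma summable_visit_term: "summable (visit_term A v n x)"
  by (rule summable_rabs_cancel, rule summableI_nonneg_bounded[of _ "real n"])
    (simp_all add: sum_abs_visit_term)

lemma suminf_visit_term_diff:
  assumes "m \<le> n"
  shows "\<bar>(\<Sum>r. visit_term A v n x r) - (\<Sum>r. visit_term A v m x r)\<bar> \<le> real n - real m"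
proof -
  have "(\<lambda>N. \<bar>\<Sum>r<N. visit_term A v n x r - visit_term A v m x r\<bar>) \<longlonglongrightarrow>
      \<bar>\<Sum>r. visit_term A v n x r - visit_term A v m x r\<bar>"
    by (intro tendsto_rabs summable_LIMSEQ summable_diff summable_visit_term)
  then have "\<bar>\<Sum>r. visit_term A v n x r - visit_term A v m x r\<bar> \<le> real n - real m"
    by (rule LIMSEQ_le_const2)
      (intro exI[of _ 0] allI impI order_trans[OF sum_abs sum_visit_term_diff[OF assms]])
  then show ?thesis by (simp add: suminf_diff summable_visit_term)
qed

text \<open>Every visit after time \<open>N\<close> has a number larger than
  \<open>visits A x N\<close> and is cut off. This turns statements about the stopped series into
  statements about fixed times.\<close>

lemma suminf_visit_term_visits:
  "(\<Sum>r. visit_term A v (visits A x N) x r) = (\<Sum>r\<le>N. v (x r))"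
proof -
  have "visit_term A v (visits A x N) x r = 0" if "r \<notin> {..N}" for r
  proof (cases "x r \<in> A")
    case True
    from that obtain s where s: "r = Suc s" "N \<le> s" by (cases r) auto
    then have "visits A x r = Suc (visits A x s)"
      using True by (simp add: visits_def)
    then show ?thesis using visits_mono[OF s(2), of A x] by (simp add: visit_term_def)
  next
    case False
    then show ?thesis using v_bound[of "x r"] by (simp add: visit_term_def)
  qed
  then have "(\<Sum>r. visit_term A v (visits A x N) x r) = (\<Sum>r\<le>N. visit_term A v (visits A x N) x r)"
    by (intro suminf_finite) auto
  also have "\<dots> = (\<Sum>r\<le>N. v (x r))"
    by (intro sum.cong refl) (simp add: visit_term_def visits_mono)
  finally show ?thesis .
qed

end

section \<open>Limit lemmas\<close>

text \<open>The largest square not exceeding \<open>n\<close> is within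
  \<open>2 * floor_sqrt n\<close> of it, and by the Lipschitz bound this error is negligible after
  division by \<open>n\<close>.\<close>

lemma lipschitz_subsequence_tendsto_0:
  fixes z :: "nat \<Rightarrow> real"
  assumes lip: "\<And>m n. m \<le> n \<Longrightarrow> \<bar>z n - z m\<bar> \<le> real n - real m"
    and sub: "(\<lambda>m. z (m\<^sup>2) / real (m\<^sup>2)) \<longlonglongrightarrow> 0"
  shows "(\<lambda>n. z n / real n) \<longlonglongrightarrow> 0"
proof (rule Lim_null_comparison)
  have s: "filterlim floor_sqrt at_top sequentially"
    unfolding filterlim_at_top eventually_sequentially
    by (meson le_floor_sqrt_iff)
  have "(\<lambda>n. \<bar>z ((floor_sqrt n)\<^sup>2) / real ((floor_sqrt n)\<^sup>2)\<bar> + 2 / real (floor_sqrt n)) \<longlonglongrightarrow> \<bar>0\<bar> + 0"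
    by (intro tendsto_add tendsto_rabs filterlim_compose[OF sub s]
        filterlim_compose[OF lim_const_over_n s])
  then show "(\<lambda>n. \<bar>z ((floor_sqrt n)\<^sup>2) / real ((floor_sqrt n)\<^sup>2)\<bar> + 2 / real (floor_sqrt n)) \<longlonglongrightarrow> 0"
    by simp
  show "\<forall>\<^sub>F n in sequentially. norm (z n / real n) \<le>
      \<bar>z ((floor_sqrt n)\<^sup>2) / real ((floor_sqrt n)\<^sup>2)\<bar> + 2 / real (floor_sqrt n)"
    using eventually_gt_at_top[of 0]
  proof eventually_elim
    case (elim n)
    define s where "s = floor_sqrt n"
    have s: "s > 0" "s\<^sup>2 \<le> n" and "n < (Suc s)\<^sup>2"
      using elim Suc_floor_sqrt_power2_gt[of n] by (simp_all add: s_def)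
    then have "n \<le> s\<^sup>2 + 2 * s"
      by (simp add: power2_eq_square)
    have sr: "real (s\<^sup>2) \<le> real n" "real n \<le> real (s\<^sup>2) + 2 * real s" "0 < real (s\<^sup>2)"
      using s \<open>n \<le> s\<^sup>2 + 2 * s\<close> of_nat_mono[of n "s\<^sup>2 + 2 * s", where 'a = real] by simp_all
    have "\<bar>z n\<bar> \<le> \<bar>z (s\<^sup>2)\<bar> + 2 * real s"
      using lip[OF s(2)] sr by linarith
    then have "\<bar>z n\<bar> / real n \<le> (\<bar>z (s\<^sup>2)\<bar> + 2 * real s) / real (s\<^sup>2)"
      using sr elim by (intro frac_le) auto
    also have "\<dots> = \<bar>z (s\<^sup>2) / real (s\<^sup>2)\<bar> + 2 / real s"
      using s by (simp add: add_divide_distrib power2_eq_square)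
    finally show ?case by (simp add: s_def)
  qed
qed

lemma ratio_tendsto_of_balance:
  fixes a b :: "nat \<Rightarrow> real"
  assumes nonneg: "\<And>N. 0 \<le> a N" "\<And>N. 0 \<le> b N" and pos: "0 < \<alpha>" "0 < \<beta>"
    and div: "\<forall>\<^sub>F N in sequentially. 0 < a N + b N"
    and bal: "(\<lambda>N. (\<alpha> * a N - \<beta> * b N) / (a N + b N)) \<longlonglongrightarrow> 0"
  shows "(\<lambda>N. a N / b N) \<longlonglongrightarrow> \<beta> / \<alpha>"
proof -
  define t where "t = (\<lambda>N. (\<alpha> * a N - \<beta> * b N) / (a N + b N))"
  have "(\<lambda>N. (\<beta> + t N) / (\<alpha> - t N)) \<longlonglongrightarrow> (\<beta> + 0) / (\<alpha> - 0)"
    using bal pos unfolding t_def by (intro tendsto_intros) auto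
  moreover have "\<forall>\<^sub>F N in sequentially. (\<beta> + t N) / (\<alpha> - t N) = a N / b N"
    using div
  proof eventually_elim
    case (elim N)
    \<comment> \<open>If \<open>b N = 0\<close>, then \<open>\<alpha> - t N = 0\<close> as well, and
      both quotients have the default value 0.\<close>
    have "\<beta> + t N = (\<alpha> + \<beta>) * a N / (a N + b N)" "\<alpha> - t N = (\<alpha> + \<beta>) * b N / (a N + b N)"
      using elim by (simp_all add: t_def field_simps)
    then show ?case using elim pos by simp
  qed
  ultimately show ?thesis
    by (simp add: tendsto_cong)
qed

text \<open>Sum and expectation of nonnegative terms may be exchanged, so the series is finite
  almost surely and its terms tend to 0.\<close>

lemma (in prob_space) AE_tendsto_0_of_summable_expectation:
  fixes f :: "nat \<Rightarrow> 'a \<Rightarrow> real"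
  assumes int: "\<And>m. integrable M (f m)" and nonneg: "\<And>m \<omega>. 0 \<le> f m \<omega>"
    and sum: "summable (\<lambda>m. expectation (f m))"
  shows "AE \<omega> in M. (\<lambda>m. f m \<omega>) \<longlonglongrightarrow> 0"
proof -
  have [measurable]: "f m \<in> borel_measurable M" for m
    using int by auto
  have "(\<integral>\<^sup>+ \<omega>. (\<Sum>m. ennreal (f m \<omega>)) \<partial>M) = (\<Sum>m. \<integral>\<^sup>+ \<omega>. ennreal (f m \<omega>) \<partial>M)"
    by (rule nn_integral_suminf) simp
  also have "\<dots> = (\<Sum>m. ennreal (expectation (f m)))"
    using int nonneg by (simp add: nn_integral_eq_integral)
  also have "\<dots> = ennreal (\<Sum>m. expectation (f m))"
    using sum nonneg by (intro suminf_ennreal2) auto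
  finally have "(\<integral>\<^sup>+ \<omega>. (\<Sum>m. ennreal (f m \<omega>)) \<partial>M) \<noteq> \<infinity>" by simp
  then have "AE \<omega> in M. (\<Sum>m. ennreal (f m \<omega>)) \<noteq> \<infinity>"
    by (intro nn_integral_PInf_AE) auto
  then show ?thesis
  proof eventually_elim
    case (elim \<omega>)
    then have "summable (\<lambda>m. f m \<omega>)"
      using nonneg by (intro summable_suminf_not_top) auto
    then show ?case by (rule summable_LIMSEQ_zero)
  qed
qed

lemma adapted_mono: "adapted X m f \<Longrightarrow> m \<le> n \<Longrightarrow> adapted X n f"
  unfolding adapted_def by (meson order_trans)

lemma adapted_of_state: "i \<le> n \<Longrightarrow> adapted X n (\<lambda>\<omega>. \<phi> (X i \<omega>))"
  and adapted_const: "adapted X n (\<lambda>\<omega>. c)"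
  unfolding adapted_def by auto

lemma adapted_power:
  assumes "adapted X n f"
  shows "adapted X n (\<lambda>\<omega>. f \<omega> ^ k)"
  using assms unfolding adapted_def by metis

lemma
  assumes "adapted X n f" "adapted X n g"
  shows adapted_add: "adapted X n (\<lambda>\<omega>. f \<omega> + g \<omega>)"
    and adapted_diff: "adapted X n (\<lambda>\<omega>. f \<omega> - g \<omega>)"
    and adapted_mult: "adapted X n (\<lambda>\<omega>. f \<omega> * g \<omega>)"
  using assms unfolding adapted_def by metis+

lemma adapted_sum: "(\<And>i. i \<in> J \<Longrightarrow> adapted X n (f i)) \<Longrightarrow> adapted X n (\<lambda>\<omega>. \<Sum>i\<in>J. f i \<omega>)"
  unfolding adapted_def by (auto intro!: sum.cong)

lemma adapted_visits: "r \<le> n \<Longrightarrow> adapted X n (\<lambda>\<omega>. F (visits A (\<lambda>i. X i \<omega>) r))"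
  unfolding adapted_def visits_def by (auto intro!: arg_cong[where f = F] sum.cong)

lemmas adapted_intros = adapted_of_state adapted_const adapted_power adapted_add adapted_diff
  adapted_mult adapted_sum

section \<open>The second moment of the stopped sum\<close>

context finite_range_markov_chain
begin

text \<open>The sum \<open>Z\<close> differs from the stopped martingale \<open>Y\<close> by a
  telescoping term of size at most 1. The second moment of \<open>Y\<close> is at most
  \<open>1 + 2 * n\<close>; passing to \<open>Z\<close> doubles this bound and adds 2.\<close>

lemma second_moment_visit_term:
  assumes h: "\<And>x. 0 \<le> h x \<and> h x \<le> 1"
    and v: "\<And>x. h x - avg h x = v x" and v_bound: "\<And>x. \<bar>v x\<bar> \<le> of_bool (x \<in> A)"
  shows "expectation (\<lambda>\<omega>. (\<Sum>r<N. visit_term A v n (\<lambda>i. X i \<omega>) r)\<^sup>2) \<le> 4 * real n + 4"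
proof -
  define I :: "nat \<Rightarrow> 'a \<Rightarrow> real" where "I = (\<lambda>r \<omega>. of_bool (visits A (\<lambda>i. X i \<omega>) r \<le> n))"
  define m where "m = (\<lambda>r \<omega>. avg h (X r \<omega>))"
  define D where "D = (\<lambda>r \<omega>. h (X (Suc r) \<omega>) - m r \<omega>)"
  define Y where "Y = (\<lambda>N \<omega>. \<Sum>r<N. I r \<omega> * D r \<omega>)"
  define Z where "Z = (\<lambda>\<omega>. \<Sum>r<N. visit_term A v n (\<lambda>i. X i \<omega>) r)"
  \<comment> \<open>Stands in for the squared increment: \<open>I * D\<^sup>2\<close> and
    \<open>Q\<close> differ by \<open>2 * I * m * D\<close>, of mean 0, and the sum of
    \<open>Q\<close> can be bounded along each path.\<close>
  define Q where "Q = (\<lambda>r \<omega>. I r \<omega> * ((h (X (Suc r) \<omega>))\<^sup>2 - (m r \<omega>)\<^sup>2))"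
  have I_ad: "adapted X k (I r)" if "r \<le> k" for r k
    unfolding I_def using that by (rule adapted_visits)
  have m_ad: "adapted X k (m r)" if "r \<le> k" for r k
    unfolding m_def using that by (rule adapted_of_state)
  have D_ad: "adapted X k (D r)" if "r < k" for r k
    unfolding D_def using that by (intro adapted_intros m_ad) auto
  have Q_ad: "adapted X (Suc r) (Q r)" for r
    unfolding Q_def by (intro adapted_intros I_ad m_ad) auto
  have Y_ad: "adapted X k (Y r)" if "r \<le> k" for r k
    unfolding Y_def using that by (intro adapted_intros I_ad D_ad) auto
  have Z_ad: "adapted X N Z"
    unfolding Z_def visit_term_def by (intro adapted_intros adapted_visits) auto
  have mart: "expectation (\<lambda>\<omega>. g \<omega> * D r \<omega>) = 0" if g: "adapted X r g" for g r
  proof -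
    have gm: "adapted X r (\<lambda>\<omega>. g \<omega> * m r \<omega>)"
      using g by (intro adapted_intros m_ad) auto
    have gh: "adapted X (Suc r) (\<lambda>\<omega>. g \<omega> * h (X (Suc r) \<omega>))"
      using adapted_mono[OF g] by (intro adapted_intros) auto
    have "expectation (\<lambda>\<omega>. g \<omega> * D r \<omega>) = expectation (\<lambda>\<omega>. g \<omega> * h (X (Suc r) \<omega>)) - expectation (\<lambda>\<omega>. g \<omega> * m r \<omega>)"
      unfolding D_def right_diff_distrib
      using gm gh by (intro Bochner_Integration.integral_diff adapted_integrable)
    also have "\<dots> = 0" unfolding expectation_Suc[OF g] m_def by simp
    finally show ?thesis .
  qed
  have Y2: "expectation (\<lambda>\<omega>. (Y k \<omega>)\<^sup>2) = (\<Sum>r<k. expectation (Q r))" for k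
  proof (induction k)
    case 0
    then show ?case by (simp add: Y_def)
  next
    case (Suc k)
    have YI: "adapted X k (\<lambda>\<omega>. 2 * Y k \<omega> * I k \<omega> - 2 * I k \<omega> * m k \<omega>)"
      by (intro adapted_intros Y_ad I_ad m_ad) auto
    \<comment> \<open>\<open>I\<close> is 0 or 1, hence its own square; the coefficient of
      \<open>D k\<close> is known at time \<open>k\<close>, so that term has mean 0.\<close>
    have eq: "(Y (Suc k) \<omega>)\<^sup>2 = (Y k \<omega>)\<^sup>2 + (2 * Y k \<omega> * I k \<omega> - 2 * I k \<omega> * m k \<omega>) * D k \<omega> + Q k \<omega>" for \<omega>
    proof -
      have Y_Suc: "Y (Suc k) \<omega> = Y k \<omega> + I k \<omega> * D k \<omega>" by (simp add: Y_def)
      have "I k \<omega> = 0 \<or> I k \<omega> = 1" by (simp add: I_def)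
      then show ?thesis
        unfolding Y_Suc Q_def D_def by (elim disjE) (simp_all add: power2_eq_square algebra_simps)
    qed
    have i1: "integrable M (\<lambda>\<omega>. (Y k \<omega>)\<^sup>2)"
      by (intro adapted_integrable[of k] adapted_intros Y_ad) auto
    have i2: "integrable M (\<lambda>\<omega>. (2 * Y k \<omega> * I k \<omega> - 2 * I k \<omega> * m k \<omega>) * D k \<omega>)"
      by (intro adapted_integrable[of "Suc k"] adapted_intros Y_ad I_ad m_ad D_ad) auto
    show ?case
      unfolding eq
      using i1 i2 adapted_integrable[OF Q_ad] Suc mart[OF YI]
      by simp
  qed
  \<comment> \<open>Inserting \<open>h\<^sup>2\<close> at the present state leaves a telescoping
    sum, at most 1, and \<open>h\<^sup>2 - m\<^sup>2 = v * (h + m)\<close>, which costs at most 2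
    per visit to \<open>A\<close>.\<close>
  have sumQ: "(\<Sum>r<N. Q r \<omega>) \<le> 1 + 2 * real n" for \<omega>
  proof -
    obtain k where k: "(\<Sum>r<N. I r \<omega> * ((h (X (Suc r) \<omega>))\<^sup>2 - (h (X r \<omega>))\<^sup>2)) = (h (X k \<omega>))\<^sup>2 - (h (X 0 \<omega>))\<^sup>2"
      unfolding I_def using sum_stopped_increments[OF antimono_visits_le, where N = N and g = "\<lambda>r. (h (X r \<omega>))\<^sup>2"] by blast
    have "(\<Sum>r<N. Q r \<omega>) \<le> (\<Sum>r<N. I r \<omega> * ((h (X (Suc r) \<omega>))\<^sup>2 - (h (X r \<omega>))\<^sup>2) + 2 * \<bar>visit_term A (\<lambda>x. of_bool (x \<in> A)) n (\<lambda>i. X i \<omega>) r\<bar>)"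
    proof (rule sum_mono)
      fix r
      have "(h (X r \<omega>))\<^sup>2 - (m r \<omega>)\<^sup>2 = v (X r \<omega>) * (h (X r \<omega>) + m r \<omega>)"
        using v[of "X r \<omega>"] by (simp add: m_def power2_eq_square algebra_simps flip: v)
      also have "\<dots> \<le> \<bar>v (X r \<omega>)\<bar> * \<bar>h (X r \<omega>) + m r \<omega>\<bar>"
        by (simp flip: abs_mult)
      also have "\<dots> \<le> of_bool (X r \<omega> \<in> A) * 2"
        using h[of "X r \<omega>"] avg_bounds[of h "X r \<omega>", OF h] by (intro mult_mono v_bound) (auto simp: m_def)
      finally show "Q r \<omega> \<le> I r \<omega> * ((h (X (Suc r) \<omega>))\<^sup>2 - (h (X r \<omega>))\<^sup>2) + 2 * \<bar>visit_term A (\<lambda>x. of_bool (x \<in> A)) n (\<lambda>i. X i \<omega>) r\<bar>"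
        by (auto simp: Q_def I_def visit_term_def)
    qed
    also have "\<dots> = (h (X k \<omega>))\<^sup>2 - (h (X 0 \<omega>))\<^sup>2 + 2 * (\<Sum>r<N. \<bar>visit_term A (\<lambda>x. of_bool (x \<in> A)) n (\<lambda>i. X i \<omega>) r\<bar>)"
      by (simp add: sum.distrib k sum_distrib_left)
    also have "\<dots> \<le> 1 - 0 + 2 * real n"
      using h by (intro add_mono diff_mono mult_left_mono sum_abs_visit_term) (auto simp: power_le_one)
    finally show ?thesis by simp
  qed
  have "expectation (\<lambda>\<omega>. (Y N \<omega>)\<^sup>2) = expectation (\<lambda>\<omega>. \<Sum>r<N. Q r \<omega>)"
    unfolding Y2 using adapted_integrable[OF Q_ad] by (subst Bochner_Integration.integral_sum) auto
  also have "\<dots> \<le> expectation (\<lambda>\<omega>. 1 + 2 * real n)"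
    using adapted_integrable[OF Q_ad] sumQ by (intro integral_mono) auto
  also have "\<dots> = 1 + 2 * real n"
    by (simp add: prob_space)
  finally have EY: "expectation (\<lambda>\<omega>. (Y N \<omega>)\<^sup>2) \<le> 1 + 2 * real n" .
  have YZ: "(Z \<omega>)\<^sup>2 \<le> 2 * (Y N \<omega>)\<^sup>2 + 2" for \<omega>
  proof -
    obtain k where k: "(\<Sum>r<N. I r \<omega> * (h (X (Suc r) \<omega>) - h (X r \<omega>))) = h (X k \<omega>) - h (X 0 \<omega>)"
      unfolding I_def using sum_stopped_increments[OF antimono_visits_le, where N = N and g = "\<lambda>r. h (X r \<omega>)"] by blast
    have "Y N \<omega> - Z \<omega> = (\<Sum>r<N. I r \<omega> * (h (X (Suc r) \<omega>) - h (X r \<omega>)))"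
      unfolding Y_def Z_def sum_subtractf[symmetric] visit_term_def I_def D_def m_def
      by (simp add: algebra_simps flip: v)
    then have "\<bar>Y N \<omega> - Z \<omega>\<bar> \<le> 1"
      using h[of "X k \<omega>"] h[of "X 0 \<omega>"] by (simp add: k abs_le_iff)
    then have "(Y N \<omega> - Z \<omega>)\<^sup>2 \<le> 1" by (simp add: abs_square_le_1)
    \<comment> \<open>The parallelogram identity, which bounds \<open>Z\<^sup>2\<close> by
      \<open>2 * Y\<^sup>2\<close> plus twice the squared difference.\<close>
    moreover have "(Z \<omega>)\<^sup>2 + (2 * Y N \<omega> - Z \<omega>)\<^sup>2 = 2 * (Y N \<omega>)\<^sup>2 + 2 * (Y N \<omega> - Z \<omega>)\<^sup>2"
      by (simp add: power2_eq_square algebra_simps)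
    ultimately show ?thesis using zero_le_power2[of "2 * Y N \<omega> - Z \<omega>"] by linarith
  qed
  have iY: "integrable M (\<lambda>\<omega>. (Y N \<omega>)\<^sup>2)" and iZ: "integrable M (\<lambda>\<omega>. (Z \<omega>)\<^sup>2)"
    by (intro adapted_integrable[of N] adapted_intros Y_ad Z_ad order_refl)+
  have "expectation (\<lambda>\<omega>. (Z \<omega>)\<^sup>2) \<le> expectation (\<lambda>\<omega>. 2 * (Y N \<omega>)\<^sup>2 + 2)"
    using iY iZ YZ by (intro integral_mono) auto
  also have "\<dots> = 2 * expectation (\<lambda>\<omega>. (Y N \<omega>)\<^sup>2) + 2"
    using iY by (simp add: prob_space)
  finally show ?thesis using EY unfolding Z_def by linarith
qed

end

section \<open>The ratio of local times\<close>

text \<open>The partial sums are bounded by \<open>n\<close>, so dominated convergence carries the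
  estimate over to the whole series.\<close>

lemma (in finite_range_markov_chain) second_moment_suminf_visit_term:
  assumes h: "\<And>x. 0 \<le> h x \<and> h x \<le> 1"
    and v: "\<And>x. h x - avg h x = v x" and v_bound: "\<And>x. \<bar>v x\<bar> \<le> of_bool (x \<in> A)"
  shows "integrable M (\<lambda>\<omega>. (\<Sum>r. visit_term A v n (\<lambda>i. X i \<omega>) r)\<^sup>2)"
    and "expectation (\<lambda>\<omega>. (\<Sum>r. visit_term A v n (\<lambda>i. X i \<omega>) r)\<^sup>2) \<le> 4 * real n + 4"
proof -
  let ?Z = "\<lambda>N \<omega>. \<Sum>r<N. visit_term A v n (\<lambda>i. X i \<omega>) r"
  have "adapted X N (?Z N)" for N
    unfolding visit_term_def by (intro adapted_intros adapted_visits) auto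
  then have meas [measurable]: "?Z N \<in> borel_measurable M" for N
    using adapted_integrable by (metis borel_measurable_integrable)
  have lim: "(\<lambda>N. ?Z N \<omega>) \<longlonglongrightarrow> (\<Sum>r. visit_term A v n (\<lambda>i. X i \<omega>) r)" for \<omega>
    by (intro summable_LIMSEQ summable_visit_term v_bound)
  then have meas' [measurable]: "(\<lambda>\<omega>. \<Sum>r. visit_term A v n (\<lambda>i. X i \<omega>) r) \<in> borel_measurable M"
    by (rule borel_measurable_LIMSEQ_real) (rule meas)
  have bound: "norm ((?Z N \<omega>)\<^sup>2) \<le> (real n)\<^sup>2" for N \<omega>
    using power_mono[OF abs_sum_visit_term[where v = v and A = A, OF v_bound], of n "\<lambda>i. X i \<omega>" N 2] by simp
  have *: "AE \<omega> in M. (\<lambda>N. (?Z N \<omega>)\<^sup>2) \<longlonglongrightarrow> (\<Sum>r. visit_term A v n (\<lambda>i. X i \<omega>) r)\<^sup>2"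
    using lim by (intro AE_I2 tendsto_power)
  show "integrable M (\<lambda>\<omega>. (\<Sum>r. visit_term A v n (\<lambda>i. X i \<omega>) r)\<^sup>2)"
    by (rule integrable_dominated_convergence[where s = "\<lambda>N \<omega>. (?Z N \<omega>)\<^sup>2" and w = "\<lambda>_. (real n)\<^sup>2"])
      (use * bound in auto)
  have "(\<lambda>N. expectation (\<lambda>\<omega>. (?Z N \<omega>)\<^sup>2)) \<longlonglongrightarrow> expectation (\<lambda>\<omega>. (\<Sum>r. visit_term A v n (\<lambda>i. X i \<omega>) r)\<^sup>2)"
    by (rule integral_dominated_convergence[where w = "\<lambda>_. (real n)\<^sup>2"]) (use * bound in auto)
  then show "expectation (\<lambda>\<omega>. (\<Sum>r. visit_term A v n (\<lambda>i. X i \<omega>) r)\<^sup>2) \<le> 4 * real n + 4"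
    by (rule LIMSEQ_le_const2) (use second_moment_visit_term[OF h v v_bound] in blast)
qed

section \<open>Growth and balance of local times\<close>

lemma local_time_nonneg: "0 \<le> local_time X z N \<omega>"
  unfolding local_time_def by (rule sum_nonneg) simp

lemma local_time_at_top:
  assumes "\<forall>n. \<exists>i\<ge>n. X i \<omega> = z"
  shows "filterlim (\<lambda>N. local_time X z N \<omega>) at_top sequentially"
proof -
  have inc: "incseq (\<lambda>N. local_time X z N \<omega>)"
    unfolding local_time_def by (intro incseq_SucI) simp
  have "\<exists>N. real k \<le> local_time X z N \<omega>" for k
  proof (induction k)
    case 0
    then show ?case by (auto simp: local_time_nonneg)
  next
    case (Suc k)
    then obtain N where N: "real k \<le> local_time X z N \<omega>" by blast
    obtain i where i: "i \<ge> Suc N" "X i \<omega> = z" using assms by blast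
    then obtain j where j: "i = Suc j" "N \<le> j" by (cases i) auto
    have "local_time X z i \<omega> = local_time X z j \<omega> + 1"
      using i j by (simp add: local_time_def)
    then show ?case using N incseqD[OF inc j(2)] by (intro exI[of _ i]) simp
  qed
  show ?thesis
    unfolding filterlim_at_top eventually_sequentially
  proof
    fix B :: real
    obtain k N where "B \<le> real k" "real k \<le> local_time X z N \<omega>"
      using real_arch_simple \<open>\<And>k. \<exists>N. real k \<le> local_time X z N \<omega>\<close> by blast
    then show "\<exists>N. \<forall>n\<ge>N. B \<le> local_time X z n \<omega>"
      using incseqD[OF inc] by (intro exI[of _ N]) fastforce
  qed
qed

context recurrent_reversible_chain
begin

lemma local_time_balance:
  assumes ab: "a \<noteq> b"
  shows "AE \<omega> in M. (\<lambda>N. (local_time X a N \<omega> / \<mu> a - local_time X b N \<omega> / \<mu> b) /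
    (local_time X a N \<omega> + local_time X b N \<omega>)) \<longlonglongrightarrow> 0"
proof -
  obtain c h where c: "0 < c" and h: "\<And>x. 0 \<le> h x \<and> h x \<le> 1"
    and v_eq: "\<And>x. h x - avg h x = c * (of_bool (x = a) / \<mu> a - of_bool (x = b) / \<mu> b)"
    using potential_exists[OF ab] by blast
  define A where "A = {a, b}"
  define v where "v = (\<lambda>x. h x - avg h x)"
  have v_bound: "\<bar>v x\<bar> \<le> of_bool (x \<in> A)" for x
  proof (cases "x \<in> A")
    case True
    then show ?thesis using h[of x] avg_bounds[of h x, OF h] by (simp add: v_def abs_le_iff)
  next
    case False
    then show ?thesis by (simp add: v_def v_eq A_def)
  qed
  define z where "z = (\<lambda>\<omega> n. \<Sum>r. visit_term A v n (\<lambda>i. X i \<omega>) r)"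
  have z2: "integrable M (\<lambda>\<omega>. (z \<omega> n)\<^sup>2)" "expectation (\<lambda>\<omega>. (z \<omega> n)\<^sup>2) \<le> 4 * real n + 4" for n
    unfolding z_def using second_moment_suminf_visit_term[of h v A n] h v_bound by (auto simp: v_def)
  \<comment> \<open>Along squares the second moment of the quotient is of order
    \<open>1 / m\<^sup>2\<close>, hence summable; along all \<open>n\<close> the bound would only be
    of order \<open>1 / n\<close>.\<close>
  have "AE \<omega> in M. (\<lambda>m. (z \<omega> (m\<^sup>2) / real (m\<^sup>2))\<^sup>2) \<longlonglongrightarrow> 0"
  proof (rule AE_tendsto_0_of_summable_expectation)
    show "integrable M (\<lambda>\<omega>. (z \<omega> (m\<^sup>2) / real (m\<^sup>2))\<^sup>2)" for m
      using z2(1) by (simp add: power_divide)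
    show "summable (\<lambda>m. expectation (\<lambda>\<omega>. (z \<omega> (m\<^sup>2) / real (m\<^sup>2))\<^sup>2))"
    proof (rule summable_comparison_test)
      show "summable (\<lambda>m. 8 * inverse (real m ^ 2))"
        by (intro summable_mult inverse_power_summable) simp
      have "expectation (\<lambda>\<omega>. (z \<omega> (m\<^sup>2) / real (m\<^sup>2))\<^sup>2) \<le> 8 * inverse (real m ^ 2)" if "m \<ge> 1" for m
      proof -
        have m: "1 \<le> (real m)\<^sup>2" using that by simp
        have "expectation (\<lambda>\<omega>. (z \<omega> (m\<^sup>2) / real (m\<^sup>2))\<^sup>2) \<le> (4 * real (m\<^sup>2) + 4) / ((real (m\<^sup>2))\<^sup>2)"
          using z2(2)[of "m\<^sup>2"] by (simp add: power_divide divide_right_mono)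
        also have "\<dots> \<le> 8 * (real m)\<^sup>2 / ((real (m\<^sup>2))\<^sup>2)"
          using m by (intro divide_right_mono) auto
        also have "\<dots> = 8 * inverse (real m ^ 2)"
          using that by (simp add: power2_eq_square field_simps)
        finally show ?thesis .
      qed
      then show "\<exists>N. \<forall>m\<ge>N. norm (expectation (\<lambda>\<omega>. (z \<omega> (m\<^sup>2) / real (m\<^sup>2))\<^sup>2)) \<le> 8 * inverse (real m ^ 2)"
        by (intro exI[of _ 1]) auto
    qed
  qed simp
  moreover have "AE \<omega> in M. \<forall>n. \<exists>i\<ge>n. X i \<omega> = a" by (rule infinitely_often)
  ultimately show ?thesis
  proof eventually_elim
    case (elim \<omega>)
    have sub: "(\<lambda>m. z \<omega> (m\<^sup>2) / real (m\<^sup>2)) \<longlonglongrightarrow> 0"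
    proof (rule tendsto_rabs_zero_cancel)
      show "(\<lambda>m. \<bar>z \<omega> (m\<^sup>2) / real (m\<^sup>2)\<bar>) \<longlonglongrightarrow> 0"
        using tendsto_real_sqrt[OF elim(1)] by (simp only: real_sqrt_abs real_sqrt_zero)
    qed
    have z_lim: "(\<lambda>n. z \<omega> n / real n) \<longlonglongrightarrow> 0"
    proof (rule lipschitz_subsequence_tendsto_0[OF _ sub])
      show "\<bar>z \<omega> n - z \<omega> m\<bar> \<le> real n - real m" if "m \<le> n" for m n
        unfolding z_def using that by (rule suminf_visit_term_diff[of v A, OF v_bound])
    qed
    have vis: "real (visits A (\<lambda>i. X i \<omega>) N) = local_time X a N \<omega> + local_time X b N \<omega>" for N
      unfolding visits_def local_time_def sum.distrib[symmetric] of_nat_sum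
      using ab by (intro sum.cong) (auto simp: A_def)
    have "filterlim (\<lambda>N. local_time X a N \<omega> + local_time X b N \<omega>) at_top sequentially"
      by (rule filterlim_at_top_mono[OF local_time_at_top[where X = X and z = a, OF elim(2)]])
        (simp add: local_time_nonneg)
    then have "\<forall>\<^sub>F N in sequentially. real k \<le> real (visits A (\<lambda>i. X i \<omega>) N)" for k
      unfolding vis filterlim_at_top by blast
    \<comment> \<open>Since recurrence makes \<open>visits\<close> unbounded, the limit in the
      number of visits becomes a limit in time.\<close>
    then have "filterlim (visits A (\<lambda>i. X i \<omega>)) at_top sequentially"
      by (simp add: filterlim_at_top)
    then have "(\<lambda>N. z \<omega> (visits A (\<lambda>i. X i \<omega>) N) / real (visits A (\<lambda>i. X i \<omega>) N)) \<longlonglongrightarrow> 0"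
      by (rule filterlim_compose[OF z_lim])
    then have "(\<lambda>N. inverse c * (z \<omega> (visits A (\<lambda>i. X i \<omega>) N) / (local_time X a N \<omega> + local_time X b N \<omega>)))
        \<longlonglongrightarrow> inverse c * 0"
      unfolding vis by (intro tendsto_mult tendsto_const)
    moreover have "z \<omega> (visits A (\<lambda>i. X i \<omega>) N) = c * (local_time X a N \<omega> / \<mu> a - local_time X b N \<omega> / \<mu> b)" for N
      unfolding z_def suminf_visit_term_visits[of v A, OF v_bound]
      by (simp only: v_def v_eq local_time_def sum_distrib_left[symmetric] sum_subtractf sum_divide_distrib)
    ultimately show ?case using c by (simp add: mult.assoc[symmetric] flip: times_divide_eq_right)
  qed
qed

theorem local_time_ratio:
  "AE \<omega> in M. (\<lambda>N. local_time X a N \<omega> / local_time X b N \<omega>) \<longlonglongrightarrow> \<mu> a / \<mu> b"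
proof (cases "a = b")
  \<comment> \<open>The potential exists for distinct states; for \<open>a = b\<close> it is enough
    that the denominator is eventually positive.\<close>
  case True
  have "AE \<omega> in M. \<forall>n. \<exists>i\<ge>n. X i \<omega> = a" by (rule infinitely_often)
  then show ?thesis
  proof eventually_elim
    case (elim \<omega>)
    have "\<forall>\<^sub>F N in sequentially. 0 < local_time X a N \<omega>"
      using local_time_at_top[where X = X and z = a, OF elim] by (simp add: filterlim_at_top_dense)
    then have "\<forall>\<^sub>F N in sequentially. local_time X a N \<omega> / local_time X b N \<omega> = 1"
      by eventually_elim (use True in simp)
    then show ?case using True \<mu>_pos[of b] by (simp add: tendsto_eventually)
  qed
next
  case False
  have "AE \<omega> in M. \<forall>n. \<exists>i\<ge>n. X i \<omega> = a" by (rule infinitely_often)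
  with local_time_balance[OF False] show ?thesis
  proof eventually_elim
    case (elim \<omega>)
    have "\<forall>\<^sub>F N in sequentially. 0 < local_time X a N \<omega>"
      using local_time_at_top[where X = X and z = a, OF elim(2)] by (simp add: filterlim_at_top_dense)
    then have "\<forall>\<^sub>F N in sequentially. 0 < local_time X a N \<omega> + local_time X b N \<omega>"
      by eventually_elim (use local_time_nonneg[of X b _ \<omega>] in \<open>simp add: add_pos_nonneg\<close>)
    then have "(\<lambda>N. local_time X a N \<omega> / local_time X b N \<omega>) \<longlonglongrightarrow> (1 / \<mu> b) / (1 / \<mu> a)"
      using elim(1) \<mu>_pos by (intro ratio_tendsto_of_balance) (auto simp: local_time_nonneg)
    then show ?case by simp
  qed
qed

end

section \<open>The half-plane half-comb walk\<close>

text \<open>All four lattice neighbours are listed in every row; on the teeth the horizontal ones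
  have probability 0.\<close>

definition hphc_nb :: "int \<times> int \<Rightarrow> (int \<times> int) set" where
  "hphc_nb = (\<lambda>(k, j). {(k + 1, j), (k - 1, j), (k, j + 1), (k, j - 1)})"

text \<open>Detailed balance across the edge between rows 0 and -1,
  \<open>2 * 1/4 = 1 * 1/2\<close>, fixes the factor 2 that becomes the limit in the
  theorem.\<close>

definition hphc_weight :: "int \<times> int \<Rightarrow> real" where
  "hphc_weight = (\<lambda>(k, j). if j \<ge> 0 then 2 else 1)"

interpretation hphc_kernel: finite_range_kernel hphc_step hphc_nb
  by unfold_locales (auto simp: hphc_step_def hphc_nb_def hphc_p_def split: prod.splits if_splits)

lemma hphc_avg:
  "hphc_kernel.avg \<phi> (k, j) = (if j \<ge> 0 then (\<phi> (k + 1, j) + \<phi> (k - 1, j) + \<phi> (k, j + 1) + \<phi> (k, j - 1)) / 4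
     else (\<phi> (k, j + 1) + \<phi> (k, j - 1)) / 2)"
  unfolding hphc_kernel.avg_def by (simp add: hphc_nb_def hphc_step_def hphc_p_def)

text \<open>Vertical moves are possible everywhere and horizontal ones on row 0, so any two states
  are joined through that row.\<close>

lemma hphc_irreducible:
  assumes "S \<noteq> {}" and step: "\<And>x y. x \<in> S \<Longrightarrow> hphc_step x y > 0 \<Longrightarrow> y \<in> S"
  shows "S = UNIV"
proof -
  have up: "(k, j + 1) \<in> S" and down: "(k, j - 1) \<in> S" if "(k, j) \<in> S" for k j
    using that by (auto intro!: step[OF that] simp: hphc_step_def hphc_p_def)
  have right: "(k + 1, 0) \<in> S" and left: "(k - 1, 0) \<in> S" if "(k, 0) \<in> S" for k
    using that by (auto intro!: step[OF that] simp: hphc_step_def hphc_p_def)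
  have vert: "(k, j') \<in> S" if "(k, j) \<in> S" for k j j'
    by (induction j' rule: int_induct[where k = j]) (use that up down in auto)
  obtain k0 j0 where "(k0, j0) \<in> S" using assms(1) by auto
  then have 0: "(k0, 0) \<in> S" by (rule vert)
  have "(k, 0) \<in> S" for k
    by (induction k rule: int_induct[where k = k0]) (use 0 left right in auto)
  then show ?thesis using vert by (auto simp: set_eq_iff)
qed

text \<open>The planar radius \<open>k\<^sup>2 + j\<^sup>2 - 1\<close>, extended affinely along the teeth. Its logarithm is superharmonic
  off a finite set: for \<open>ln (k\<^sup>2 + j\<^sup>2)\<close> itself this fails along the diagonals, hence the \<open>-1\<close>.\<close>

definition hphc_radius :: "int \<times> int \<Rightarrow> real" where
  "hphc_radius = (\<lambda>(k, j). real_of_int (if j \<ge> 0 then k\<^sup>2 + j\<^sup>2 - 1 else k\<^sup>2 - j - 1))"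

text \<open>The cut at 1 keeps the logarithm nonnegative near the origin; off the exceptional box
  all radii compared are at least 1, so the bare logarithm is seen there.\<close>

definition hphc_lyapunov :: "int \<times> int \<Rightarrow> real" where
  "hphc_lyapunov z = ln (max 1 (hphc_radius z))"

lemma sum_ln_le:
  fixes a b c d R :: real
  assumes "a > 0" "b > 0" "c > 0" "d > 0" "R > 0" "(a * b) * (c * d) \<le> R ^ 4"
  shows "ln a + ln b + ln c + ln d \<le> 4 * ln R"
proof -
  have "ln ((a * b) * (c * d)) \<le> ln (R ^ 4)"
    using assms by (subst ln_le_cancel_iff) auto
  then show ?thesis using assms by (simp add: ln_mult ln_realpow)
qed

lemma square_ge:
  fixes x :: real
  assumes "0 \<le> c" "c \<le> \<bar>x\<bar>"
  shows "c\<^sup>2 \<le> x\<^sup>2"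
  using power_mono[OF assms(2,1), of 2] by simp

lemma hphc_lyapunov_eq: "hphc_radius z = r \<Longrightarrow> 1 \<le> r \<Longrightarrow> hphc_lyapunov z = ln r"
  by (simp add: hphc_lyapunov_def max_absorb2)

text \<open>Through \<open>sum_ln_le\<close> each region reduces to a polynomial inequality: the
  product of the neighbouring radii is at most the fourth power of the radius at the point.\<close>

lemma hphc_lyapunov_superharmonic:
  assumes "(k, j) \<notin> {-5..5} \<times> {-30..30}"
  shows "hphc_kernel.avg hphc_lyapunov (k, j) \<le> hphc_lyapunov (k, j)"
proof -
  define x where "x = real_of_int k"
  define y where "y = real_of_int j"
  have large: "\<bar>x\<bar> \<ge> 6 \<or> \<bar>y\<bar> \<ge> 31"
  proof -
    have "\<bar>k\<bar> \<ge> 6 \<or> \<bar>j\<bar> \<ge> 31" using assms by auto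
    then show ?thesis unfolding x_def y_def by linarith
  qed
  consider "j > 0" | "j = 0" | "j < 0" by linarith
  then show ?thesis
  proof cases
    case 1
    define R where "R = x\<^sup>2 + y\<^sup>2 - 1"
    have sq: "(\<bar>x\<bar> - 1)\<^sup>2 + y\<^sup>2 \<ge> 25" "x\<^sup>2 + (\<bar>y\<bar> - 1)\<^sup>2 \<ge> 25" "R \<ge> 24"
      using large square_ge[of 5 "\<bar>x\<bar> - 1"] square_ge[of 31 y] square_ge[of 6 x] square_ge[of 30 "\<bar>y\<bar> - 1"]
      by (auto simp: R_def intro: add_increasing add_increasing2)
    have pos: "R + 1 + 2 * x \<ge> 1" "R + 1 - 2 * x \<ge> 1" "R + 1 + 2 * y \<ge> 1" "R + 1 - 2 * y \<ge> 1"
      using sq by (auto simp: R_def power2_eq_square algebra_simps abs_if split: if_splits)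
    \<comment> \<open>The square discarded next vanishes on the diagonals; what remains is
      \<open>(R\<^sup>2 - 1)\<^sup>2\<close>, at most \<open>R ^ 4\<close>.\<close>
    have "((R + 1 + 2 * x) * (R + 1 - 2 * x)) * ((R + 1 + 2 * y) * (R + 1 - 2 * y))
        = (R + 1) ^ 4 - 4 * (R + 1) ^ 3 + 4 * (R + 1)\<^sup>2 - 4 * (x\<^sup>2 - y\<^sup>2)\<^sup>2"
      unfolding R_def by algebra
    also have "\<dots> \<le> (R + 1) ^ 4 - 4 * (R + 1) ^ 3 + 4 * (R + 1)\<^sup>2" by simp
    also have "\<dots> = R ^ 4 - 2 * R\<^sup>2 + 1" by algebra
    also have "\<dots> \<le> R ^ 4" using one_le_power[of R 2] sq by linarith
    finally have ln_le: "ln (R + 1 + 2 * x) + ln (R + 1 - 2 * x) + ln (R + 1 + 2 * y) + ln (R + 1 - 2 * y) \<le> 4 * ln R"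
      using pos sq by (intro sum_ln_le) auto
    have radius: "hphc_radius (k + 1, j) = R + 1 + 2 * x" "hphc_radius (k - 1, j) = R + 1 - 2 * x"
      "hphc_radius (k, j + 1) = R + 1 + 2 * y" "hphc_radius (k, j - 1) = R + 1 - 2 * y" "hphc_radius (k, j) = R"
      using 1 by (simp_all add: hphc_radius_def R_def x_def y_def power2_eq_square algebra_simps)
    have "R \<ge> 1" using sq by simp
    note lyapunov = radius(1)[THEN hphc_lyapunov_eq, OF pos(1)] radius(2)[THEN hphc_lyapunov_eq, OF pos(2)]
      radius(3)[THEN hphc_lyapunov_eq, OF pos(3)] radius(4)[THEN hphc_lyapunov_eq, OF pos(4)]
      radius(5)[THEN hphc_lyapunov_eq, OF this]
    show ?thesis
      unfolding hphc_avg lyapunov using 1 ln_le by simp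
  next
    case 2
    then have x: "x\<^sup>2 \<ge> 36" "\<bar>x\<bar> \<ge> 6"
      using large square_ge[of 6 x] by (auto simp: y_def)
    have "(\<bar>x\<bar> - 1)\<^sup>2 \<ge> 25"
      using x square_ge[of 5 "\<bar>x\<bar> - 1"] by simp
    then have pos: "x\<^sup>2 + 2 * x \<ge> 1" "x\<^sup>2 - 2 * x \<ge> 1"
      by (auto simp: power2_eq_square algebra_simps abs_if split: if_splits)
    have "((x\<^sup>2 + 2 * x) * (x\<^sup>2 - 2 * x)) * (x\<^sup>2 * x\<^sup>2) = (x\<^sup>2 - 1) ^ 4 - (6 * (x\<^sup>2)\<^sup>2 - 4 * x\<^sup>2 + 1)"
      by algebra
    also have "\<dots> \<le> (x\<^sup>2 - 1) ^ 4"
    proof -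
      have "36 * x\<^sup>2 \<le> x\<^sup>2 * x\<^sup>2" using x by (intro mult_right_mono) auto
      then show ?thesis using x by (simp add: power2_eq_square[of "x\<^sup>2"])
    qed
    finally have ln_le: "ln (x\<^sup>2 + 2 * x) + ln (x\<^sup>2 - 2 * x) + ln (x\<^sup>2) + ln (x\<^sup>2) \<le> 4 * ln (x\<^sup>2 - 1)"
      using pos x by (intro sum_ln_le) auto
    have radius: "hphc_radius (k + 1, j) = x\<^sup>2 + 2 * x" "hphc_radius (k - 1, j) = x\<^sup>2 - 2 * x"
      "hphc_radius (k, j + 1) = x\<^sup>2" "hphc_radius (k, j - 1) = x\<^sup>2" "hphc_radius (k, j) = x\<^sup>2 - 1"
      using 2 by (simp_all add: hphc_radius_def x_def power2_eq_square algebra_simps)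
    have x1: "x\<^sup>2 \<ge> 1" "x\<^sup>2 - 1 \<ge> 1" using x by auto
    note lyapunov = radius(1)[THEN hphc_lyapunov_eq, OF pos(1)] radius(2)[THEN hphc_lyapunov_eq, OF pos(2)]
      radius(3,4)[THEN hphc_lyapunov_eq, OF x1(1)] radius(5)[THEN hphc_lyapunov_eq, OF x1(2)]
    show ?thesis
      unfolding hphc_avg lyapunov using 2 ln_le by simp
  next
    case 3
    define R where "R = x\<^sup>2 - y - 1"
    have "y < 0" using 3 by (simp add: y_def)
    moreover have "x\<^sup>2 \<ge> 36 \<or> \<bar>y\<bar> \<ge> 31" using large square_ge[of 6 x] by auto
    ultimately have R: "R \<ge> 2"
      using zero_le_power2[of x] unfolding R_def by linarith
    \<comment> \<open>On a tooth only two neighbours have positive probability; each is counted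
      twice to fit \<open>sum_ln_le\<close>.\<close>
    have "((R + 1) * (R - 1)) * ((R + 1) * (R - 1)) = R ^ 4 - 2 * R\<^sup>2 + 1" by algebra
    also have "\<dots> \<le> R ^ 4" using one_le_power[of R 2] R by linarith
    finally have ln_le: "ln (R + 1) + ln (R - 1) + ln (R + 1) + ln (R - 1) \<le> 4 * ln R"
      using R by (intro sum_ln_le) auto
    \<comment> \<open>For \<open>j = -1\<close> the upper neighbour lies on row 0, where the planar
      and the affine formula agree.\<close>
    have radius_up: "hphc_radius (k, j + 1) = R - 1"
    proof (cases "j = -1")
      case True
      then show ?thesis by (simp add: hphc_radius_def R_def x_def y_def)
    next
      case False
      then show ?thesis using 3 by (simp add: hphc_radius_def R_def x_def y_def)
    qed
    have radius: "hphc_radius (k, j - 1) = R + 1" "hphc_radius (k, j) = R"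
      using 3 by (simp_all add: hphc_radius_def R_def x_def y_def)
    have R1: "R - 1 \<ge> 1" "R + 1 \<ge> 1" "R \<ge> 1" using R by auto
    note lyapunov = radius_up[THEN hphc_lyapunov_eq, OF R1(1)]
      radius(1)[THEN hphc_lyapunov_eq, OF R1(2)] radius(2)[THEN hphc_lyapunov_eq, OF R1(3)]
    show ?thesis
      unfolding hphc_avg lyapunov using 3 ln_le by simp
  qed
qed

lemma finite_hphc_lyapunov_level: "finite {z. hphc_lyapunov z \<le> c}"
proof (rule finite_subset)
  define B where "B = \<lceil>exp c\<rceil> + 1"
  show "{z. hphc_lyapunov z \<le> c} \<subseteq> {-B..B} \<times> {-B..B}"
  proof clarify
    fix k j assume "hphc_lyapunov (k, j) \<le> c"
    then have "exp (hphc_lyapunov (k, j)) \<le> exp c" by simp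
    then have "hphc_radius (k, j) \<le> exp c" by (simp add: hphc_lyapunov_def)
    then have le: "(if j \<ge> 0 then k\<^sup>2 + j\<^sup>2 - 1 else k\<^sup>2 - j - 1) \<le> \<lceil>exp c\<rceil>"
      unfolding hphc_radius_def by (simp only: prod.case) linarith
    have abs_le: "\<bar>i\<bar> \<le> i\<^sup>2" for i :: int
    proof (cases "i = 0")
      case False
      then have "\<bar>i\<bar> * 1 \<le> \<bar>i\<bar> * \<bar>i\<bar>" by (intro mult_left_mono) auto
      then show ?thesis by (simp add: power2_eq_square)
    qed simp
    show "k \<in> {-B..B} \<and> j \<in> {-B..B}"
      using le abs_le[of k] abs_le[of j] unfolding B_def atLeastAtMost_iff by (auto split: if_splits)
  qed
qed simp

section \<open>The walk as a recurrent reversible chain\<close>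

interpretation hphc: recurrent_reversible_kernel hphc_step hphc_nb hphc_weight
proof
  fix x y :: "int \<times> int"
  show "0 < hphc_weight x" by (simp add: hphc_weight_def split: prod.split)
  show "hphc_weight x * hphc_step x y = hphc_weight y * hphc_step y x"
    by (cases x; cases y) (auto simp: hphc_weight_def hphc_step_def hphc_p_def)
  fix \<phi> :: "int \<times> int \<Rightarrow> real"
  assume "\<And>x. \<phi> x \<le> hphc_kernel.avg \<phi> x" "\<And>x. 0 \<le> \<phi> x \<and> \<phi> x \<le> 1"
  then show "\<phi> x = \<phi> y"
  proof (intro hphc_kernel.liouville_lyapunov[where F = "{-5..5} \<times> {-30..30}" and f = hphc_lyapunov and B = 1])
    show "hphc_kernel.avg hphc_lyapunov z \<le> hphc_lyapunov z" if "z \<notin> {-5..5} \<times> {-30..30}" for z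
      using that hphc_lyapunov_superharmonic by (cases z) blast
    show "S = UNIV" if "S \<noteq> {}" "\<And>x y. x \<in> S \<Longrightarrow> hphc_step x y > 0 \<Longrightarrow> y \<in> S" for S
      using that by (rule hphc_irreducible)
  qed (auto simp: finite_hphc_lyapunov_level, simp add: hphc_lyapunov_def)
qed

theorem corollary4p1:
  fixes M :: "'a measure" and C :: "nat \<Rightarrow> 'a \<Rightarrow> int \<times> int" and k1 k2 :: int
  assumes "hphc_walk M C"
  shows "(\<forall>j1 j2 :: int. (j1 \<ge> 0 \<and> j2 \<ge> 0) \<or> (j1 < 0 \<and> j2 < 0) \<longrightarrow>
            (AE \<omega> in M. (\<lambda>N. local_time C (k1, j1) N \<omega> / local_time C (k2, j2) N \<omega>) \<longlonglongrightarrow> 1)) \<and>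
         (\<forall>j1 j2 :: int. j1 \<ge> 0 \<and> j2 < 0 \<longrightarrow>
            (AE \<omega> in M. (\<lambda>N. local_time C (k1, j1) N \<omega> / local_time C (k2, j2) N \<omega>) \<longlonglongrightarrow> 2))"
proof -
  interpret recurrent_reversible_chain hphc_step hphc_nb hphc_weight M C "(0, 0)"
    by unfold_locales (use assms in \<open>auto simp: hphc_walk_def\<close>)
  have lim: "AE \<omega> in M. (\<lambda>N. local_time C (k1, j1) N \<omega> / local_time C (k2, j2) N \<omega>) \<longlonglongrightarrow> q"
    if "hphc_weight (k1, j1) / hphc_weight (k2, j2) = q" for j1 j2 q
    using local_time_ratio[of "(k1, j1)" "(k2, j2)"] that by simp
  show ?thesis
    by (intro conjI allI impI lim) (auto simp: hphc_weight_def)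
qed

end
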